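(* Consider a multicriteria minimization problem $\min_{x\in\mathcal{X}}Cx$ with set of feasible solutions $\mathcal{X}\subseteq\{0,1\}^n$ and cost matrix $C\in\mathbb{Z}^{k\times n}_{\ge0}$, and let $p\in[1,\infty]$. Suppose that 1. for any instance $I=(\mathcal{X},C)$ and any feasible reference point $\bar y$, a lower bound $L$ and an upper bound $U$ on $\min_{x\in\mathcal{X}}r(Cx)$ can be computed in time $\pi_1(|I|)$ such that $U\le\pi_2(|I|)L$, where $\pi_1,\pi_2$ are non-decreasing polynomials, and 2. there is an algorithm that solves $\min_{x\in\mathcal{X}}r(Cx)$ for any instance $I=(\mathcal{X},C)$ in time $\pi_3(|I|,U)$, where $\pi_3$ is a non-decreasing polynomial. Then there is an FPTAS for $\min_{x\in\mathcal{X}}r(Cx)$, where $r(y)=\|\bar y\|_{[p]}+\|y-\bar y\|_{[p]}$.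
   Context: $|I|$ denotes the encoding length of the instance $I$. The ideal point is $y^{\mathrm{id}}_i=\min_{x\in\mathcal{X}}(Cx)_i$; a feasible reference point is $\bar y\in\mathbb{Z}^k_{\ge0}$ with $\bar y\le y^{\mathrm{id}}$ componentwise. The cornered $p$-norm is $\|y\|_{[p]}=\max_i|y_i|+\frac1p\sum_i|y_i|$ for $p\ge1$, and $\|y\|_{[\infty]}=\max_i|y_i|$. An FPTAS is a family of algorithms containing, for every $\epsilon>0$, an algorithm returning $x\in\mathcal{X}$ with $r(Cx)\le(1+\epsilon)\min_{z\in\mathcal{X}}r(Cz)$ in time polynomial in $|I|$ and $1/\epsilon$. *)

theory Defs
  imports
    "HOL-Library.Discrete_Functions"
    "HOL-Library.Extended_Real"
    "HOL-Computational_Algebra.Polynomial"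
    "Jordan_Normal_Form.Matrix"
begin

section \<open>Model of computation\<close>

text \<open>
  Algorithms are programs of a small combinator language over binary trees whose leaves are
  natural numbers. Running time is measured by the logarithmic cost criterion: every elementary
  operation, including arithmetic, is charged the binary length of the data it reads and writes
  (as for the logarithmic-cost RAM of Aho, Hopcroft and Ullman). The model is
  Turing complete, and its polynomial-time computable functions are those of Turing machines:
  an elementary operation is computable in time polynomial in its charge, and conversely
  a Turing machine configuration is a pair of lists of symbols, updated at linear cost.
\<close>

datatype data = Num nat | Pair data data

fun bit_size :: "data \<Rightarrow> nat" where
  "bit_size (Num m) = floor_log m + 1"
| "bit_size (Pair a b) = 1 + bit_size a + bit_size b"

datatype elem_op = Id | Const data | Fst | Snd | IsPair | Add | Sub | Mul | Div

text \<open>Ill-typed applications return \<open>0\<close>; subtraction is truncated and division rounds down.\<close>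

fun elem_val :: "elem_op \<Rightarrow> data \<Rightarrow> data" where
  "elem_val Id x = x"
| "elem_val (Const c) x = c"
| "elem_val Fst (Pair a b) = a"
| "elem_val Snd (Pair a b) = b"
| "elem_val IsPair (Pair a b) = Num 1"
| "elem_val Add (Pair (Num a) (Num b)) = Num (a + b)"
| "elem_val Sub (Pair (Num a) (Num b)) = Num (a - b)"
| "elem_val Mul (Pair (Num a) (Num b)) = Num (a * b)"
| "elem_val Div (Pair (Num a) (Num b)) = Num (a div b)"
| "elem_val _ _ = Num 0"

datatype prog =
    Elem elem_op
  | Fork prog prog
  | Seq prog prog
  | If prog prog prog
  | While prog prog

text \<open>
  \<open>exec A x y t\<close>: program \<open>A\<close>, started on input \<open>x\<close>, halts with output \<open>y\<close> after time \<open>t\<close>.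
  A test succeeds if its value is not \<open>Num 0\<close>.
\<close>

inductive exec :: "prog \<Rightarrow> data \<Rightarrow> data \<Rightarrow> nat \<Rightarrow> bool" where
  Elem: "exec (Elem f) x (elem_val f x) (bit_size x + bit_size (elem_val f x))"
| Fork: "exec A x a s \<Longrightarrow> exec B x b t \<Longrightarrow> exec (Fork A B) x (Pair a b) (1 + bit_size x + s + t)"
| Seq: "exec A x y s \<Longrightarrow> exec B y z t \<Longrightarrow> exec (Seq A B) x z (1 + s + t)"
| If_true: "exec T x c s \<Longrightarrow> c \<noteq> Num 0 \<Longrightarrow> exec A x y t \<Longrightarrow>
    exec (If T A B) x y (1 + bit_size x + s + t)"
| If_false: "exec T x (Num 0) s \<Longrightarrow> exec B x y t \<Longrightarrow>
    exec (If T A B) x y (1 + bit_size x + s + t)"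
| While_stop: "exec T x (Num 0) s \<Longrightarrow> exec (While T A) x x (1 + bit_size x + s)"
| While_step: "exec T x c s \<Longrightarrow> c \<noteq> Num 0 \<Longrightarrow> exec A x y t \<Longrightarrow> exec (While T A) y z u \<Longrightarrow>
    exec (While T A) x z (1 + bit_size x + s + t + u)"

lemma exec_deterministic:
  "exec A x y s \<Longrightarrow> exec A x z t \<Longrightarrow> z = y \<and> t = s"
proof (induction arbitrary: z t rule: exec.induct)
  case (Elem f x)
  then show ?case by cases auto
next
  case (Fork A x a s B b t)
  from Fork.prems show ?case by cases (use Fork.IH in blast)+
next
  case (Seq A x y s B z t)
  from Seq.prems show ?case by cases (use Seq.IH in blast)+
next
  case (If_true T x c s A y t B)
  from If_true.prems show ?case by cases (use If_true.IH If_true.hyps in blast)+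
next
  case (If_false T x s B y t A)
  from If_false.prems show ?case by cases (use If_false.IH If_false.hyps in blast)+
next
  case (While_stop T x s A)
  from While_stop.prems show ?case by cases (use While_stop.IH While_stop.hyps in blast)+
next
  case (While_step T x c s A y t z u)
  from While_step.prems show ?case by cases (use While_step.IH While_step.hyps in blast)+
qed

lemma exec_output_bit_size: "exec A x y t \<Longrightarrow> bit_size y \<le> t"
  by (induction rule: exec.induct) auto

definition runs_within :: "prog \<Rightarrow> data \<Rightarrow> data \<Rightarrow> real \<Rightarrow> bool" where
  "runs_within A x y b \<longleftrightarrow> (\<exists>t. exec A x y t \<and> real t \<le> b)"


section \<open>Encodings\<close>

fun enc_list :: "data list \<Rightarrow> data" where
  "enc_list [] = Num 0"
| "enc_list (a # as) = Pair a (enc_list as)"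

definition enc_vec :: "nat vec \<Rightarrow> data" where
  "enc_vec v = enc_list (map Num (list_of_vec v))"

definition enc_mat :: "nat mat \<Rightarrow> data" where
  "enc_mat M = enc_list (map (\<lambda>row. enc_list (map Num row)) (mat_to_list M))"

definition represents :: "data \<Rightarrow> real \<Rightarrow> bool" where
  "represents d q \<longleftrightarrow> (\<exists>a b. d = Pair (Num a) (Num b) \<and> b > 0 \<and> q = real a / real b)"


section \<open>Multicriteria minimization problems\<close>

text \<open>
  The feasible set of an instance is given implicitly (by a graph, say). A problem therefore
  consists of a set of descriptions \<open>s\<close>, each determining the dimensions \<open>n = num_vars P s\<close>
  and \<open>k = num_crit P s\<close> and the set of feasible solutions \<open>feasible P s\<close>; a problem with
  a fixed number of criteria is one where \<open>num_crit P\<close> is constant. An instance consists of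
  a description and an arbitrary nonnegative integral cost matrix of matching dimensions.
\<close>

record mc_problem =
  descriptions :: "data set"
  num_vars :: "data \<Rightarrow> nat"
  num_crit :: "data \<Rightarrow> nat"
  feasible :: "data \<Rightarrow> nat vec set"

definition multicriteria_problem :: "mc_problem \<Rightarrow> bool" where
  "multicriteria_problem P \<longleftrightarrow> (\<forall>s\<in>descriptions P.
     num_crit P s \<ge> 1 \<and> feasible P s \<noteq> {} \<and>
     feasible P s \<subseteq> {x \<in> carrier_vec (num_vars P s). \<forall>j<num_vars P s. x $ j \<in> {0, 1}})"

type_synonym mc_instance = "data \<times> nat mat"

definition instances :: "mc_problem \<Rightarrow> mc_instance set" where
  "instances P = {(s, C). s \<in> descriptions P \<and> C \<in> carrier_mat (num_crit P s) (num_vars P s)}"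

definition solutions :: "mc_problem \<Rightarrow> mc_instance \<Rightarrow> nat vec set" where
  "solutions P I = feasible P (fst I)"

definition cost :: "mc_instance \<Rightarrow> nat vec \<Rightarrow> nat vec" where
  "cost I x = snd I *\<^sub>v x"

definition enc_instance :: "mc_instance \<Rightarrow> data" where
  "enc_instance I = Pair (fst I) (enc_mat (snd I))"

definition enc_input :: "mc_instance \<Rightarrow> nat vec \<Rightarrow> data" where
  "enc_input I ybar = Pair (enc_instance I) (enc_vec ybar)"

definition encoding_length :: "mc_instance \<Rightarrow> real" where
  "encoding_length I = real (bit_size (enc_instance I))"

definition ideal_point :: "mc_problem \<Rightarrow> mc_instance \<Rightarrow> nat vec" where
  "ideal_point P I = vec (num_crit P (fst I)) (\<lambda>i. Min ((\<lambda>x. cost I x $ i) ` solutions P I))"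

definition reference_points :: "mc_problem \<Rightarrow> mc_instance \<Rightarrow> nat vec set" where
  "reference_points P I = {ybar \<in> carrier_vec (num_crit P (fst I)).
     \<forall>i<num_crit P (fst I). ybar $ i \<le> ideal_point P I $ i}"

definition cornered_norm :: "ereal \<Rightarrow> real vec \<Rightarrow> real" where
  "cornered_norm p y =
     (if p = \<infinity> then Max ((\<lambda>i. \<bar>y $ i\<bar>) ` {..<dim_vec y})
      else Max ((\<lambda>i. \<bar>y $ i\<bar>) ` {..<dim_vec y})
           + 1 / real_of_ereal p * (\<Sum>i<dim_vec y. \<bar>y $ i\<bar>))"

definition ref_obj :: "ereal \<Rightarrow> nat vec \<Rightarrow> nat vec \<Rightarrow> real" where
  "ref_obj p ybar y =
     cornered_norm p (map_vec real ybar) + cornered_norm p (map_vec real y - map_vec real ybar)"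

definition opt_val :: "mc_problem \<Rightarrow> ereal \<Rightarrow> mc_instance \<Rightarrow> nat vec \<Rightarrow> real" where
  "opt_val P p I ybar = Min ((\<lambda>x. ref_obj p ybar (cost I x)) ` solutions P I)"


section \<open>Bivariate polynomials and approximation schemes\<close>

definition poly2 :: "real poly poly \<Rightarrow> real \<Rightarrow> real \<Rightarrow> real" where
  "poly2 q x y = poly (poly q [:y:]) x"

definition nondecreasing :: "real poly \<Rightarrow> bool" where
  "nondecreasing q \<longleftrightarrow> mono_on {0..} (poly q)"

definition nondecreasing2 :: "real poly poly \<Rightarrow> bool" where
  "nondecreasing2 q \<longleftrightarrow>
     (\<forall>x x' y y'. 0 \<le> x \<and> x \<le> x' \<and> 0 \<le> y \<and> y \<le> y' \<longrightarrow> poly2 q x y \<le> poly2 q x' y')"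

definition has_fptas :: "mc_problem \<Rightarrow> ereal \<Rightarrow> bool" where
  "has_fptas P p \<longleftrightarrow> (\<exists>q. \<forall>\<epsilon>>0. \<exists>A. \<forall>I\<in>instances P. \<forall>ybar\<in>reference_points P I.
     \<exists>x\<in>solutions P I.
       runs_within A (enc_input I ybar) (enc_vec x) (poly2 q (encoding_length I) (1 / \<epsilon>)) \<and>
       ref_obj p ybar (cost I x) \<le> (1 + \<epsilon>) * opt_val P p I ybar)"

end

theory Submission
  imports Defs
begin

text \<open>
  Let \<open>L = a / b\<close> be the lower bound and let \<open>m \<ge> 1 / \<epsilon>\<close> be an integer. If \<open>L = 0\<close>, then \<open>U = 0\<close> and
  the exact algorithm is fast on the given instance. Otherwise costs are measured in units of
  \<open>D = L / (m N)\<close>, where \<open>N\<close> is polynomial in the dimensions: the entries of \<open>C / D\<close> are rounded up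
  and those of \<open>ybar / D\<close> are rounded down, so that the rounded reference point stays below the
  rounded ideal point. As \<open>ybar \<le> C x\<close>, the objective is the sum of \<open>max ybar\<close>, \<open>max (C x - ybar)\<close> and
  a multiple of the sum of the entries of \<open>C x\<close>, hence rounding changes it by at most \<open>N\<close> units, that
  is by \<open>L / m \<le> \<epsilon> L\<close>. The optimal value of the rounded instance is at most \<open>U / D + N\<close>, which is
  polynomially bounded because \<open>U / L\<close> is, and so is the running time of the exact algorithm on it.
\<close>

section \<open>Polynomial bounds\<close>

text \<open>The polynomial in \<open>has_fptas\<close> is fixed before \<epsilon>, so polynomial
  time has to be proved uniformly: the accuracy m is treated as part of the input of one
  preprocessing program, and is hard-wired as a constant once \<epsilon> is given. Two sizes of m
  must be kept apart. Preprocessing reads m in binary, whereas the exact algorithm, whose time grows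
  with the value of an upper bound, pays for m by value; this is where 1/\<epsilon> enters.

  The exact algorithm runs on the rounded instance, so its time is governed by the upper bound for
  that instance and not for the given one. That bound is controlled by applying the ratio assumption
  a second time, to the rounded instance, and by comparing the two optimal values.

  The preprocessing never evaluates the objective, so p may be irrational: 1/p enters only the error
  analysis, as a weight between 0 and 1. What has to be computed is integer arithmetic on a, b, m,
  the dimensions and the entries. The explicit programs for it are hidden behind closure rules for
  computability in polynomial time.\<close>

definition poly_bounded :: "'i set \<Rightarrow> ('i \<Rightarrow> nat) \<Rightarrow> ('i \<Rightarrow> nat) \<Rightarrow> bool" where
  "poly_bounded S u v \<longleftrightarrow> (\<exists>c. \<forall>i\<in>S. v i \<le> (u i + 2) ^ c)"

lemma poly_boundedI: "(\<And>i. i \<in> S \<Longrightarrow> v i \<le> (u i + 2) ^ c) \<Longrightarrow> poly_bounded S u v"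
  unfolding poly_bounded_def by blast

lemma poly_bounded_mono:
  assumes "poly_bounded S u w" and "\<And>i. i \<in> S \<Longrightarrow> v i \<le> w i"
  shows "poly_bounded S u v"
  using assms unfolding poly_bounded_def by (meson order_trans)

lemma poly_bounded_refl: "poly_bounded S u u"
  by (rule poly_boundedI[of _ _ _ 1]) simp

text \<open>The base \<open>u i + 2\<close> is at least 2, so a constant \<open>k\<close> is
  absorbed as \<open>2 ^ k\<close>. Pure powers without coefficients leave a single exponent to
  choose, uniformly over \<open>S\<close>.\<close>

lemma poly_bounded_const: "poly_bounded S u (\<lambda>_. k)"
proof (rule poly_boundedI)
  fix i
  have "k \<le> 2 ^ k" by (simp add: less_imp_le)
  also have "\<dots> \<le> (u i + 2) ^ k" by (rule power_mono) auto
  finally show "k \<le> (u i + 2) ^ k" .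
qed

lemma poly_bounded_mult:
  assumes "poly_bounded S u v" and "poly_bounded S u w"
  shows "poly_bounded S u (\<lambda>i. v i * w i)"
proof -
  obtain c d where "\<forall>i\<in>S. v i \<le> (u i + 2) ^ c" "\<forall>i\<in>S. w i \<le> (u i + 2) ^ d"
    using assms unfolding poly_bounded_def by blast
  then show ?thesis
    by (intro poly_boundedI[of _ _ _ "c + d"]) (auto simp: power_add intro!: mult_mono)
qed

text \<open>Sums reduce to products by \<open>v + w \<le> (v + 1) * (w + 1)\<close>, and adding 1
  costs one more factor of the base.\<close>

lemma poly_bounded_add:
  assumes "poly_bounded S u v" and "poly_bounded S u w"
  shows "poly_bounded S u (\<lambda>i. v i + w i)"
proof (rule poly_bounded_mono)
  show "poly_bounded S u (\<lambda>i. (v i + 1) * (w i + 1))"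
  proof (rule poly_bounded_mult)
    have *: "poly_bounded S u (\<lambda>i. z i + 1)" if z: "poly_bounded S u z" for z
    proof -
      obtain c where c: "\<forall>i\<in>S. z i \<le> (u i + 2) ^ c"
        using z unfolding poly_bounded_def by blast
      have "z i + 1 \<le> (u i + 2) ^ Suc c" if "i \<in> S" for i
      proof -
        have "z i + 1 \<le> 2 * (u i + 2) ^ c"
          using bspec[OF c that] one_le_power[of "u i + 2" c] by linarith
        also have "\<dots> \<le> (u i + 2) ^ Suc c" by simp
        finally show ?thesis .
      qed
      then show ?thesis by (rule poly_boundedI)
    qed
    show "poly_bounded S u (\<lambda>i. v i + 1)" "poly_bounded S u (\<lambda>i. w i + 1)"
      using * assms by blast+
  qed
qed auto

lemma poly_bounded_power:
  "poly_bounded S u v \<Longrightarrow> poly_bounded S u (\<lambda>i. v i ^ c)"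
  by (induction c) (auto intro: poly_bounded_const poly_bounded_mult)

lemmas poly_bounded_intros =
  poly_bounded_refl poly_bounded_const poly_bounded_add poly_bounded_mult poly_bounded_power

lemma poly_bounded_trans:
  assumes "poly_bounded S u v" and "poly_bounded S v w"
  shows "poly_bounded S u w"
proof -
  obtain c where c: "\<forall>i\<in>S. w i \<le> (v i + 2) ^ c"
    using assms(2) unfolding poly_bounded_def by blast
  have "poly_bounded S u (\<lambda>i. (v i + 2) ^ c)"
    by (intro poly_bounded_intros assms)
  then show ?thesis by (rule poly_bounded_mono) (use c in auto)
qed

lemma poly_bounded_le: "(\<And>i. i \<in> S \<Longrightarrow> v i \<le> u i) \<Longrightarrow> poly_bounded S u v"
  by (rule poly_bounded_mono[OF poly_bounded_refl])

text \<open>Horner's scheme. Coefficients may be negative, hence the absolute values; natural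
  arguments suffice because encoding lengths are natural numbers.\<close>

lemma poly_bounded_poly:
  fixes q :: "real poly"
  shows "\<exists>c. \<forall>n. \<bar>poly q (real n)\<bar> \<le> real ((n + 2) ^ c)"
proof -
  have "\<exists>v. poly_bounded UNIV (\<lambda>n. n) v \<and> (\<forall>n. \<bar>poly q (real n)\<bar> \<le> real (v n))"
  proof (induction q)
    case 0
    show ?case by (rule exI[of _ "\<lambda>_. 0"]) (auto intro: poly_bounded_intros)
  next
    case (pCons a q)
    then obtain v where v: "poly_bounded UNIV (\<lambda>n. n) v"
      "\<And>n. \<bar>poly q (real n)\<bar> \<le> real (v n)" by blast
    have "\<bar>poly (pCons a q) (real n)\<bar> \<le> real (nat \<lceil>\<bar>a\<bar>\<rceil> + n * v n)" for n
    proof -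
      have "\<bar>poly (pCons a q) (real n)\<bar> \<le> \<bar>a\<bar> + real n * \<bar>poly q (real n)\<bar>"
        using abs_triangle_ineq[of a "real n * poly q (real n)"] by (simp add: abs_mult)
      also have "\<dots> \<le> real (nat \<lceil>\<bar>a\<bar>\<rceil>) + real n * real (v n)"
        by (intro add_mono mult_left_mono v(2)) auto
      finally show ?thesis by simp
    qed
    moreover have "poly_bounded UNIV (\<lambda>n. n) (\<lambda>n. nat \<lceil>\<bar>a\<bar>\<rceil> + n * v n)"
      by (intro poly_bounded_intros v)
    ultimately show ?case by (intro exI conjI allI)
  qed
  then show ?thesis
    unfolding poly_bounded_def by (meson UNIV_I of_nat_le_iff order_trans)
qed

text \<open>\<open>q\<close> is a polynomial in \<open>y\<close> whose coefficients are polynomials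
  in \<open>x\<close>: Horner's scheme runs over \<open>y\<close> and uses the univariate bound for
  each coefficient.\<close>

lemma poly_bounded_poly2:
  fixes q :: "real poly poly"
  shows "\<exists>c. \<forall>x y. \<bar>poly2 q (real x) (real y)\<bar> \<le> real ((x + y + 2) ^ c)"
proof -
  let ?u = "\<lambda>(x, y). x + y"
  have "\<exists>v. poly_bounded UNIV ?u v \<and> (\<forall>x y. \<bar>poly2 q (real x) (real y)\<bar> \<le> real (v (x, y)))"
  proof (induction q)
    case 0
    show ?case by (rule exI[of _ "\<lambda>_. 0"]) (auto simp: poly2_def intro: poly_bounded_intros)
  next
    case (pCons a q)
    then obtain v where v: "poly_bounded UNIV ?u v"
      "\<And>x y. \<bar>poly2 q (real x) (real y)\<bar> \<le> real (v (x, y))" by blast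
    obtain c where c: "\<And>n. \<bar>poly a (real n)\<bar> \<le> real ((n + 2) ^ c)"
      using poly_bounded_poly by blast
    let ?w = "\<lambda>(x, y). (x + 2) ^ c + y * v (x, y)"
    have "\<bar>poly2 (pCons a q) (real x) (real y)\<bar> \<le> real (?w (x, y))" for x y
    proof -
      have "\<bar>poly2 (pCons a q) (real x) (real y)\<bar>
          \<le> \<bar>poly a (real x)\<bar> + real y * \<bar>poly2 q (real x) (real y)\<bar>"
        using abs_triangle_ineq[of "poly a (real x)" "real y * poly2 q (real x) (real y)"]
        by (simp add: abs_mult poly2_def)
      also have "\<dots> \<le> real ((x + 2) ^ c) + real y * real (v (x, y))"
        by (intro add_mono mult_left_mono v(2) c) auto
      finally show ?thesis by simp
    qed
    moreover have "poly_bounded UNIV ?u ?w"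
    proof (rule poly_bounded_mono)
      show "poly_bounded UNIV ?u (\<lambda>i. (?u i + 2) ^ c + ?u i * v i)"
        by (intro poly_bounded_intros v)
    qed (auto intro!: add_mono power_mono)
    ultimately show ?case by blast
  qed
  then obtain v where v: "poly_bounded UNIV ?u v"
    "\<And>x y. \<bar>poly2 q (real x) (real y)\<bar> \<le> real (v (x, y))" by blast
  obtain c where c: "\<And>x y. v (x, y) \<le> (x + y + 2) ^ c"
    using v(1) unfolding poly_bounded_def by auto
  have "\<bar>poly2 q (real x) (real y)\<bar> \<le> real ((x + y + 2) ^ c)" for x y
    using v(2)[of x y] c[of x y] by (meson of_nat_le_iff order_trans)
  then show ?thesis by blast
qed

section \<open>Uniform polynomial-time computability\<close>

text \<open>
  The function to be computed is given by indexed families of inputs \<open>f i\<close> and outputs \<open>g i\<close>: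
  hypotheses on the inputs become part of the index set, and composition needs no image sets.
\<close>

definition poly_computable :: "'i set \<Rightarrow> ('i \<Rightarrow> data) \<Rightarrow> ('i \<Rightarrow> data) \<Rightarrow> bool" where
  "poly_computable S f g \<longleftrightarrow>
     (\<exists>A \<tau>. poly_bounded S (\<lambda>i. bit_size (f i)) \<tau> \<and> (\<forall>i\<in>S. exec A (f i) (g i) (\<tau> i)))"

lemma poly_computableI:
  assumes "poly_bounded S (\<lambda>i. bit_size (f i)) \<tau>" and "\<And>i. i \<in> S \<Longrightarrow> exec A (f i) (g i) (\<tau> i)"
  shows "poly_computable S f g"
  using assms unfolding poly_computable_def by blast

lemma poly_computableE:
  assumes "poly_computable S f g"
  obtains A \<tau> where "poly_bounded S (\<lambda>i. bit_size (f i)) \<tau>"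
    and "\<And>i. i \<in> S \<Longrightarrow> exec A (f i) (g i) (\<tau> i)"
  using assms unfolding poly_computable_def by blast

lemma poly_computable_cong:
  assumes "poly_computable S f g"
    and "\<And>i. i \<in> S \<Longrightarrow> f' i = f i" and "\<And>i. i \<in> S \<Longrightarrow> g' i = g i"
  shows "poly_computable S f' g'"
  using assms unfolding poly_computable_def poly_bounded_def by simp

text \<open>Program and exponent are chosen for all of \<open>T\<close>, so they serve every family
  that factors through \<open>T\<close>. This covers restriction to a subset as well as one function
  applied to all entries of many lists.\<close>

lemma poly_computable_reindex:
  assumes "poly_computable T f g" and "\<And>i. i \<in> S \<Longrightarrow> h i \<in> T"
    and "\<And>i. i \<in> S \<Longrightarrow> f' i = f (h i)" and "\<And>i. i \<in> S \<Longrightarrow> g' i = g (h i)"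
  shows "poly_computable S f' g'"
proof -
  obtain A \<tau> where "poly_bounded T (\<lambda>i. bit_size (f i)) \<tau>"
    and A: "\<And>i. i \<in> T \<Longrightarrow> exec A (f i) (g i) (\<tau> i)"
    using assms(1) by (rule poly_computableE) auto
  then obtain c where c: "\<forall>i\<in>T. \<tau> i \<le> (bit_size (f i) + 2) ^ c"
    unfolding poly_bounded_def by blast
  have "poly_bounded S (\<lambda>i. bit_size (f' i)) (\<lambda>i. \<tau> (h i))"
    by (rule poly_boundedI[of _ _ _ c]) (use c assms in simp)
  then show ?thesis by (rule poly_computableI[where A = A]) (use A assms in simp)
qed

text \<open>Writing is charged by length, so an output is never longer than the running time.
  Composition rests on this: the second program is timed on an intermediate result of polynomial
  length.\<close>

lemma poly_computable_size:
  assumes "poly_computable S f g"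
  shows "poly_bounded S (\<lambda>i. bit_size (f i)) (\<lambda>i. bit_size (g i))"
  by (rule poly_computableE[OF assms], erule poly_bounded_mono) (blast intro: exec_output_bit_size)

lemma poly_computable_trans:
  assumes "poly_computable S f g" and "poly_computable S g h"
  shows "poly_computable S f h"
proof -
  obtain A \<sigma> where A: "poly_bounded S (\<lambda>i. bit_size (f i)) \<sigma>"
    "\<And>i. i \<in> S \<Longrightarrow> exec A (f i) (g i) (\<sigma> i)" using assms(1) by (rule poly_computableE) auto
  obtain B \<tau> where B: "poly_bounded S (\<lambda>i. bit_size (g i)) \<tau>"
    "\<And>i. i \<in> S \<Longrightarrow> exec B (g i) (h i) (\<tau> i)" using assms(2) by (rule poly_computableE) auto
  have "poly_bounded S (\<lambda>i. bit_size (f i)) \<tau>"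
    using poly_computable_size[OF assms(1)] B(1) by (rule poly_bounded_trans)
  then have "poly_bounded S (\<lambda>i. bit_size (f i)) (\<lambda>i. 1 + \<sigma> i + \<tau> i)"
    using A by (intro poly_bounded_intros)
  then show ?thesis
    by (rule poly_computableI) (use A B in \<open>blast intro: exec.Seq\<close>)
qed

lemma poly_computable_Pair:
  assumes "poly_computable S f g" and "poly_computable S f h"
  shows "poly_computable S f (\<lambda>i. Pair (g i) (h i))"
proof -
  obtain A \<sigma> where A: "poly_bounded S (\<lambda>i. bit_size (f i)) \<sigma>"
    "\<And>i. i \<in> S \<Longrightarrow> exec A (f i) (g i) (\<sigma> i)" using assms(1) by (rule poly_computableE) auto
  obtain B \<tau> where B: "poly_bounded S (\<lambda>i. bit_size (f i)) \<tau>"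
    "\<And>i. i \<in> S \<Longrightarrow> exec B (f i) (h i) (\<tau> i)" using assms(2) by (rule poly_computableE) auto
  have "poly_bounded S (\<lambda>i. bit_size (f i)) (\<lambda>i. 1 + bit_size (f i) + \<sigma> i + \<tau> i)"
    using A B by (intro poly_bounded_intros)
  then show ?thesis
    by (rule poly_computableI) (use A B in \<open>blast intro: exec.Fork\<close>)
qed

text \<open>Each branch has to be correct and fast only on the indices that reach it. Its time
  function is uncontrolled elsewhere, so the common bound adds the two powers instead of the two
  times.\<close>

lemma poly_computable_If:
  assumes "poly_computable S f t"
    and "poly_computable {i \<in> S. t i \<noteq> Num 0} f g" and "poly_computable {i \<in> S. t i = Num 0} f g"
  shows "poly_computable S f g"
proof -
  let ?u = "\<lambda>i. bit_size (f i)"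
  obtain T \<rho> where T: "poly_bounded S ?u \<rho>" "\<And>i. i \<in> S \<Longrightarrow> exec T (f i) (t i) (\<rho> i)"
    using assms(1) by (rule poly_computableE) auto
  obtain A \<sigma> where A: "poly_bounded {i \<in> S. t i \<noteq> Num 0} ?u \<sigma>"
    "\<And>i. i \<in> {i \<in> S. t i \<noteq> Num 0} \<Longrightarrow> exec A (f i) (g i) (\<sigma> i)"
    using assms(2) by (rule poly_computableE) auto
  obtain B \<tau> where B: "poly_bounded {i \<in> S. t i = Num 0} ?u \<tau>"
    "\<And>i. i \<in> {i \<in> S. t i = Num 0} \<Longrightarrow> exec B (f i) (g i) (\<tau> i)"
    using assms(3) by (rule poly_computableE) auto
  let ?b = "\<lambda>i. if t i = Num 0 then \<tau> i else \<sigma> i"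
  obtain c d where c: "\<forall>i\<in>{i \<in> S. t i \<noteq> Num 0}. \<sigma> i \<le> (?u i + 2) ^ c"
    and d: "\<forall>i\<in>{i \<in> S. t i = Num 0}. \<tau> i \<le> (?u i + 2) ^ d"
    using A(1) B(1) unfolding poly_bounded_def by blast
  have "poly_bounded S ?u (\<lambda>i. (?u i + 2) ^ c + (?u i + 2) ^ d)"
    by (intro poly_bounded_intros)
  then have "poly_bounded S ?u ?b"
    by (rule poly_bounded_mono) (use c d in \<open>auto intro: trans_le_add1 trans_le_add2\<close>)
  then have "poly_bounded S ?u (\<lambda>i. 1 + ?u i + \<rho> i + ?b i)"
    using T by (intro poly_bounded_intros)
  then show ?thesis
  proof (rule poly_computableI)
    fix i assume i: "i \<in> S"
    show "exec (If T A B) (f i) (g i) (1 + ?u i + \<rho> i + ?b i)"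
    proof (cases "t i = Num 0")
      case True
      with T(2)[OF i] B(2)[of i] i show ?thesis by (auto intro!: exec.If_false[unfolded plus_1_eq_Suc add_Suc])
    next
      case False
      with T(2)[OF i] A(2)[of i] i show ?thesis by (auto intro!: exec.If_true[unfolded plus_1_eq_Suc add_Suc])
    qed
  qed
qed

section \<open>Binary lengths of the results of elementary operations\<close>

lemma floor_log_add_le: "floor_log (a + b) \<le> floor_log a + floor_log b + 1"
proof -
  have "floor_log (a + b) \<le> floor_log (2 * max a b)"
    by (rule floor_log_le_iff) auto
  also have "\<dots> \<le> Suc (floor_log (max a b))"
    by (cases "max a b = 0") (auto simp: floor_log_twice)
  also have "\<dots> \<le> floor_log a + floor_log b + 1"
    by (auto simp: max_def)
  finally show ?thesis .
qed

lemma floor_log_mult_le: "floor_log (a * b) \<le> floor_log a + floor_log b + 1"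
proof (cases "a * b = 0")
  case False
  have "2 ^ floor_log (a * b) \<le> a * b"
    by (rule floor_log_exp2_le) (use False in auto)
  also have "\<dots> < (2 * 2 ^ floor_log a) * (2 * 2 ^ floor_log b)"
    by (intro mult_strict_mono floor_log_exp2_gt) auto
  also have "\<dots> = 2 ^ (floor_log a + floor_log b + 2)"
    by (simp add: power_add)
  finally have "floor_log (a * b) < floor_log a + floor_log b + 2"
    by (rule power_less_imp_less_exp[rotated]) simp
  then show ?thesis by simp
qed auto

lemma bit_size_Num_le: "bit_size (Num m) \<le> m + 1"
proof (cases "m = 0")
  case False
  then show ?thesis using floor_log_exp2_le[of m] less_exp[of "floor_log m"] by (simp del: less_exp)
qed simp

lemma bit_size_elem_val_le:
  "bit_size (elem_val f x) \<le> bit_size x + (case f of Const c \<Rightarrow> bit_size c | _ \<Rightarrow> 1)"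
proof (cases "(f, x)" rule: elem_val.cases)
  \<comment> \<open>Cases 6 to 9 are \<open>Add\<close>, \<open>Sub\<close>, \<open>Mul\<close> and
    \<open>Div\<close> on a pair of numbers; in the others the result is a constant or a part of the
    input.\<close>
  case (6 a b)
  then show ?thesis using floor_log_add_le[of a b] by simp
next
  case (7 a b)
  then show ?thesis using floor_log_le_iff[of "a - b" a] by simp
next
  case (8 a b)
  then show ?thesis using floor_log_mult_le[of a b] by simp
next
  case (9 a b)
  then show ?thesis using floor_log_le_iff[of "a div b" a] by simp
qed auto

lemma poly_computable_elem: "poly_computable S f (\<lambda>i. elem_val e (f i))"
proof (rule poly_computableI)
  show "exec (Elem e) (f i) (elem_val e (f i)) (bit_size (f i) + bit_size (elem_val e (f i)))" for i
    by (rule exec.Elem)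
  show "poly_bounded S (\<lambda>i. bit_size (f i)) (\<lambda>i. bit_size (f i) + bit_size (elem_val e (f i)))"
  proof (rule poly_bounded_mono)
    show "poly_bounded S (\<lambda>i. bit_size (f i))
      (\<lambda>i. bit_size (f i) + (bit_size (f i) + (case e of Const c \<Rightarrow> bit_size c | _ \<Rightarrow> 1)))"
      by (intro poly_bounded_intros)
  qed (simp add: bit_size_elem_val_le)
qed

lemma poly_computable_elem_val:
  "poly_computable S f g \<Longrightarrow> poly_computable S f (\<lambda>i. elem_val e (g i))"
  by (erule poly_computable_trans) (rule poly_computable_elem)

lemma poly_computable_refl: "poly_computable S f f"
  using poly_computable_elem[of S f Id] by simp

lemma poly_computable_const: "poly_computable S f (\<lambda>_. d)"
  using poly_computable_elem[of S f "Const d"] by simp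

text \<open>Serves where the pair shape holds only on \<open>S\<close>, as for nonempty lists, or is
  hidden under a \<open>case\<close> over the index.\<close>

lemma poly_computable_fst_eq:
  assumes "poly_computable S f g" and "\<And>i. i \<in> S \<Longrightarrow> \<exists>y. g i = Pair (h i) y"
  shows "poly_computable S f h"
  by (rule poly_computable_cong[OF poly_computable_elem_val[OF assms(1), of Fst]])
    (use assms(2) in force)+

lemma poly_computable_snd_eq:
  assumes "poly_computable S f g" and "\<And>i. i \<in> S \<Longrightarrow> \<exists>x. g i = Pair x (h i)"
  shows "poly_computable S f h"
  by (rule poly_computable_cong[OF poly_computable_elem_val[OF assms(1), of Snd]])
    (use assms(2) in force)+

lemma poly_computable_fst: "poly_computable S f (\<lambda>i. Pair (g i) (h i)) \<Longrightarrow> poly_computable S f g"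
  by (erule poly_computable_fst_eq) blast

lemma poly_computable_snd: "poly_computable S f (\<lambda>i. Pair (g i) (h i)) \<Longrightarrow> poly_computable S f h"
  by (erule poly_computable_snd_eq) blast

lemma
  assumes "poly_computable S f (\<lambda>i. Num (a i))" and "poly_computable S f (\<lambda>i. Num (b i))"
  shows poly_computable_add: "poly_computable S f (\<lambda>i. Num (a i + b i))"
    and poly_computable_diff: "poly_computable S f (\<lambda>i. Num (a i - b i))"
    and poly_computable_mult: "poly_computable S f (\<lambda>i. Num (a i * b i))"
    and poly_computable_div: "poly_computable S f (\<lambda>i. Num (a i div b i))"
  using poly_computable_elem_val[OF poly_computable_Pair[OF assms], of Add]
    poly_computable_elem_val[OF poly_computable_Pair[OF assms], of Sub]
    poly_computable_elem_val[OF poly_computable_Pair[OF assms], of Mul]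
    poly_computable_elem_val[OF poly_computable_Pair[OF assms], of Div]
  by simp_all

section \<open>Loops over lists\<close>

text \<open>Here \<open>st i j\<close> is the state after \<open>j\<close> rounds. A body that is
  polynomial in its current state is not enough, since iterating it may let the state grow
  exponentially; every intermediate state must be polynomial in the initial one, as must the number
  of rounds.\<close>

lemma poly_computable_loop:
  fixes st tst :: "'i \<Rightarrow> nat \<Rightarrow> data"
  assumes test: "poly_computable {(i, j). i \<in> S \<and> j \<le> len i} (\<lambda>(i, j). st i j) (\<lambda>(i, j). tst i j)"
    and go: "\<And>i j. i \<in> S \<Longrightarrow> j < len i \<Longrightarrow> tst i j \<noteq> Num 0"
    and stop: "\<And>i. i \<in> S \<Longrightarrow> tst i (len i) = Num 0"
    and body: "poly_computable {(i, j). i \<in> S \<and> j < len i} (\<lambda>(i, j). st i j) (\<lambda>(i, j). st i (Suc j))"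
    and len: "poly_bounded S (\<lambda>i. bit_size (st i 0)) len"
    and size: "poly_bounded {(i, j). i \<in> S \<and> j \<le> len i}
      (\<lambda>(i, j). bit_size (st i 0)) (\<lambda>(i, j). bit_size (st i j))"
  shows "poly_computable S (\<lambda>i. st i 0) (\<lambda>i. st i (len i))"
proof -
  let ?T = "{(i, j). i \<in> S \<and> j \<le> len i}" and ?B = "{(i, j). i \<in> S \<and> j < len i}"
  let ?u = "\<lambda>(i, j). bit_size (st i 0)" and ?s = "\<lambda>(i, j). bit_size (st i j)"
  obtain T \<rho> where T: "poly_bounded ?T (\<lambda>ij. bit_size ((\<lambda>(i, j). st i j) ij)) \<rho>"
    "\<And>ij. ij \<in> ?T \<Longrightarrow> exec T ((\<lambda>(i, j). st i j) ij) ((\<lambda>(i, j). tst i j) ij) (\<rho> ij)"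
    using test by (rule poly_computableE) blast
  obtain A \<tau> where A: "poly_bounded ?B (\<lambda>ij. bit_size ((\<lambda>(i, j). st i j) ij)) \<tau>"
    "\<And>ij. ij \<in> ?B \<Longrightarrow> exec A ((\<lambda>(i, j). st i j) ij) ((\<lambda>(i, j). st i (Suc j)) ij) (\<tau> ij)"
    using body by (rule poly_computableE) blast
  obtain c where c: "\<forall>ij\<in>?B. \<tau> ij \<le> (?s ij + 2) ^ c"
    using A(1) unfolding poly_bounded_def by (auto simp: case_prod_beta)
  \<comment> \<open>Cost of visiting state \<open>j\<close>. The last visit,
    \<open>j = len i\<close>, pays only for the failing test.\<close>
  define w where "w i j = 1 + bit_size (st i j) + \<rho> (i, j) + (if j < len i then \<tau> (i, j) else 0)" for i j
  have "poly_bounded ?T ?u \<rho>"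
    using poly_bounded_trans[OF size, of \<rho>] T(1) unfolding case_prod_beta by blast
  then have "poly_bounded ?T ?u (\<lambda>ij. 1 + ?s ij + \<rho> ij + (?s ij + 2) ^ c)"
    by (intro poly_bounded_intros size)
  then have "poly_bounded ?T ?u (\<lambda>(i, j). w i j)"
    by (rule poly_bounded_mono) (use c in \<open>auto simp: w_def\<close>)
  then obtain e where e: "\<And>i j. i \<in> S \<Longrightarrow> j \<le> len i \<Longrightarrow> w i j \<le> (bit_size (st i 0) + 2) ^ e"
    unfolding poly_bounded_def by auto
  \<comment> \<open>Induction on the number \<open>k\<close> of remaining rounds, because
    \<open>While_step\<close> peels off the round executed at the start.\<close>
  have run: "exec (While T A) (st i (len i - k)) (st i (len i)) (\<Sum>l = len i - k..len i. w i l)"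
    if i: "i \<in> S" and k: "k \<le> len i" for i k
    using k
  proof (induction k)
    case 0
    have "exec T (st i (len i)) (Num 0) (\<rho> (i, len i))"
      using T(2)[of "(i, len i)"] stop[OF i] i by simp
    from exec.While_stop[OF this, of A] show ?case by (simp add: w_def)
  next
    case (Suc k)
    define j where "j = len i - Suc k"
    have j: "len i - k = Suc j" "j < len i" using Suc.prems by (auto simp: j_def)
    have "exec T (st i j) (tst i j) (\<rho> (i, j))" using T(2)[of "(i, j)"] i j by simp
    moreover have "exec A (st i j) (st i (Suc j)) (\<tau> (i, j))" using A(2)[of "(i, j)"] i j by simp
    moreover have "exec (While T A) (st i (Suc j)) (st i (len i)) (\<Sum>l = Suc j..len i. w i l)"
      using Suc j by simp
    ultimately have "exec (While T A) (st i j) (st i (len i))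
        (1 + bit_size (st i j) + \<rho> (i, j) + \<tau> (i, j) + (\<Sum>l = Suc j..len i. w i l))"
      using go[OF i j(2)] by (blast intro: exec.While_step)
    moreover have "1 + bit_size (st i j) + \<rho> (i, j) + \<tau> (i, j) + (\<Sum>l = Suc j..len i. w i l)
        = (\<Sum>l = j..len i. w i l)"
      using j by (simp add: sum.atLeast_Suc_atMost[of j] w_def)
    ultimately show ?case by (simp add: j_def)
  qed
  show ?thesis
  proof (rule poly_computableI)
    show "exec (While T A) (st i 0) (st i (len i)) (\<Sum>l = 0..len i. w i l)" if "i \<in> S" for i
      using run[OF that, of "len i"] by simp
    have "poly_bounded S (\<lambda>i. bit_size (st i 0)) (\<lambda>i. (len i + 1) * (bit_size (st i 0) + 2) ^ e)"
      by (intro poly_bounded_intros len)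
    then show "poly_bounded S (\<lambda>i. bit_size (st i 0)) (\<lambda>i. \<Sum>l = 0..len i. w i l)"
    proof (rule poly_bounded_mono)
      fix i assume "i \<in> S"
      then have "(\<Sum>l = 0..len i. w i l) \<le> of_nat (card {0..len i}) * (bit_size (st i 0) + 2) ^ e"
        by (intro sum_bounded_above e) auto
      then show "(\<Sum>l = 0..len i. w i l) \<le> (len i + 1) * (bit_size (st i 0) + 2) ^ e" by simp
    qed
  qed
qed

lemma length_le_bit_size_enc_list: "length xs \<le> bit_size (enc_list xs)"
  by (induction xs) auto

lemma bit_size_le_enc_list: "x \<in> set xs \<Longrightarrow> bit_size x \<le> bit_size (enc_list xs)"
  by (induction xs) auto

lemma bit_size_enc_list_drop_le: "bit_size (enc_list (drop j xs)) \<le> bit_size (enc_list xs)"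
proof (induction xs arbitrary: j)
  case (Cons x xs)
  then show ?case using Cons.IH[of "j - 1"] by (cases j) (auto intro: le_SucI trans_le_add2)
qed auto

lemma bit_size_enc_list_le:
  assumes "\<And>x. x \<in> set xs \<Longrightarrow> bit_size x \<le> b"
  shows "bit_size (enc_list xs) \<le> 1 + length xs * (1 + b)"
  using assms by (induction xs) (auto, fastforce)

text \<open>Programs have no variables, so everything the body reads travels in the state: the fixed
  environment \<open>e i\<close>, the unread suffix of the list, and the accumulator. Only the
  accumulator can grow, hence the single size hypothesis.\<close>

lemma poly_computable_fold:
  fixes xs :: "'i \<Rightarrow> data list" and acc :: "'i \<Rightarrow> nat \<Rightarrow> data"
  assumes step: "poly_computable {(i, j). i \<in> S \<and> j < length (xs i)}
      (\<lambda>(i, j). Pair (e i) (Pair (xs i ! j) (acc i j))) (\<lambda>(i, j). acc i (Suc j))"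
    and size: "poly_bounded {(i, j). i \<in> S \<and> j \<le> length (xs i)}
      (\<lambda>(i, j). bit_size (Pair (e i) (Pair (enc_list (xs i)) (acc i 0)))) (\<lambda>(i, j). bit_size (acc i j))"
  shows "poly_computable S (\<lambda>i. Pair (e i) (Pair (enc_list (xs i)) (acc i 0)))
    (\<lambda>i. acc i (length (xs i)))"
proof -
  let ?st = "\<lambda>i j. Pair (e i) (Pair (enc_list (drop j (xs i))) (acc i j))"
  let ?T = "{(i, j). i \<in> S \<and> j \<le> length (xs i)}" and ?B = "{(i, j). i \<in> S \<and> j < length (xs i)}"
  let ?f = "\<lambda>(i, j). ?st i j"
  have parts: "poly_computable R ?f (\<lambda>(i, j). e i)"
    "poly_computable R ?f (\<lambda>(i, j). enc_list (drop j (xs i)))"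
    "poly_computable R ?f (\<lambda>(i, j). acc i j)" for R
  proof -
    show "poly_computable R ?f (\<lambda>(i, j). e i)"
      by (rule poly_computable_fst_eq[OF poly_computable_refl]) auto
    have *: "poly_computable R ?f (\<lambda>(i, j). Pair (enc_list (drop j (xs i))) (acc i j))"
      by (rule poly_computable_snd_eq[OF poly_computable_refl]) auto
    show "poly_computable R ?f (\<lambda>(i, j). enc_list (drop j (xs i)))"
      by (rule poly_computable_fst_eq[OF *]) auto
    show "poly_computable R ?f (\<lambda>(i, j). acc i j)"
      by (rule poly_computable_snd_eq[OF *]) auto
  qed
  have "poly_computable S (\<lambda>i. ?st i 0) (\<lambda>i. ?st i (length (xs i)))"
  proof (rule poly_computable_loop[where tst = "\<lambda>i j. elem_val IsPair (enc_list (drop j (xs i)))"])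
    show "poly_computable ?T ?f (\<lambda>(i, j). elem_val IsPair (enc_list (drop j (xs i))))"
      by (rule poly_computable_cong[OF poly_computable_elem_val[OF parts(2)[of ?T], of IsPair]]) auto
    show "elem_val IsPair (enc_list (drop j (xs i))) \<noteq> Num 0" if "j < length (xs i)" for i j
      by (simp add: Cons_nth_drop_Suc[OF that, symmetric])
    show "elem_val IsPair (enc_list (drop (length (xs i)) (xs i))) = Num 0" for i by simp
    have *: "poly_computable ?B ?f (\<lambda>(i, j). Pair (xs i ! j) (enc_list (drop (Suc j) (xs i))))"
      by (rule poly_computable_cong[OF parts(2)])
        (auto simp: Cons_nth_drop_Suc[symmetric])
    have hd: "poly_computable ?B ?f (\<lambda>(i, j). xs i ! j)"
      by (rule poly_computable_fst_eq[OF *]) auto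
    have tl: "poly_computable ?B ?f (\<lambda>(i, j). enc_list (drop (Suc j) (xs i)))"
      by (rule poly_computable_snd_eq[OF *]) auto
    have "poly_computable ?B ?f (\<lambda>(i, j). Pair (e i) (Pair (xs i ! j) (acc i j)))"
      by (rule poly_computable_cong[OF
            poly_computable_Pair[OF parts(1) poly_computable_Pair[OF hd parts(3)]]]) auto
    then have "poly_computable ?B ?f (\<lambda>(i, j). acc i (Suc j))"
      using step by (rule poly_computable_trans)
    from poly_computable_Pair[OF parts(1) poly_computable_Pair[OF tl this]]
    show "poly_computable ?B ?f (\<lambda>(i, j). ?st i (Suc j))"
      by (rule poly_computable_cong) auto
    show "poly_bounded S (\<lambda>i. bit_size (?st i 0)) (\<lambda>i. length (xs i))"
      by (rule poly_bounded_le) (simp add: length_le_bit_size_enc_list le_SucI trans_le_add1 trans_le_add2)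
    let ?u = "\<lambda>(i, j). bit_size (?st i 0)"
    have "poly_bounded ?T ?u (\<lambda>ij. ?u ij + (\<lambda>(i, j). bit_size (acc i j)) ij)"
      using size by (intro poly_bounded_intros) simp
    then show "poly_bounded ?T ?u (\<lambda>(i, j). bit_size (?st i j))"
      by (rule poly_bounded_mono) (auto intro: bit_size_enc_list_drop_le[THEN trans_le_add1])
  qed
  from poly_computable_snd[OF poly_computable_snd[OF this]] show ?thesis by simp
qed

text \<open>The accumulator can be extended only at its front, so one pass delivers the results in
  reverse order.\<close>

lemma poly_computable_map_rev:
  fixes xs :: "'i \<Rightarrow> 'b list" and \<alpha> :: "'b \<Rightarrow> data" and \<phi> :: "'i \<Rightarrow> 'b \<Rightarrow> data"
  assumes "poly_computable {(i, x). i \<in> S \<and> x \<in> set (xs i)} (\<lambda>(i, x). Pair (e i) (\<alpha> x)) (\<lambda>(i, x). \<phi> i x)"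
  shows "poly_computable S (\<lambda>i. Pair (e i) (enc_list (map \<alpha> (xs i)))) (\<lambda>i. enc_list (rev (map (\<phi> i) (xs i))))"
proof -
  let ?acc = "\<lambda>i j. enc_list (rev (map (\<phi> i) (take j (xs i))))"
  let ?B = "{(i, j). i \<in> S \<and> j < length (map \<alpha> (xs i))}" and ?T = "{(i, j). i \<in> S \<and> j \<le> length (map \<alpha> (xs i))}"
  have "poly_computable S (\<lambda>i. Pair (e i) (Pair (enc_list (map \<alpha> (xs i))) (?acc i 0))) (\<lambda>i. ?acc i (length (map \<alpha> (xs i))))"
  proof (rule poly_computable_fold)
    let ?f = "\<lambda>(i, j). Pair (e i) (Pair (map \<alpha> (xs i) ! j) (?acc i j))"
    have p1: "poly_computable ?B ?f (\<lambda>(i, j). e i)"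
      by (rule poly_computable_fst_eq[OF poly_computable_refl]) auto
    have p23: "poly_computable ?B ?f (\<lambda>(i, j). Pair (map \<alpha> (xs i) ! j) (?acc i j))"
      by (rule poly_computable_snd_eq[OF poly_computable_refl]) auto
    have p2: "poly_computable ?B ?f (\<lambda>(i, j). \<alpha> (xs i ! j))"
      by (rule poly_computable_fst_eq[OF p23]) auto
    have p3: "poly_computable ?B ?f (\<lambda>(i, j). ?acc i j)"
      by (rule poly_computable_snd_eq[OF p23]) auto
    have "poly_computable ?B (\<lambda>(i, j). Pair (e i) (\<alpha> (xs i ! j))) (\<lambda>(i, j). \<phi> i (xs i ! j))"
      by (rule poly_computable_reindex[OF assms, of _ "\<lambda>(i, j). (i, xs i ! j)"]) auto
    moreover have "poly_computable ?B ?f (\<lambda>(i, j). Pair (e i) (\<alpha> (xs i ! j)))"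
      by (rule poly_computable_cong[OF poly_computable_Pair[OF p1 p2]]) auto
    ultimately have "poly_computable ?B ?f (\<lambda>(i, j). \<phi> i (xs i ! j))"
      using poly_computable_trans by blast
    from poly_computable_Pair[OF this p3]
    show "poly_computable ?B ?f (\<lambda>(i, j). ?acc i (Suc j))"
      by (rule poly_computable_cong) (auto simp: take_Suc_conv_app_nth)
  next
    \<comment> \<open>One exponent serves all entries, and no entry is longer than the whole list.
      The accumulator thus holds at most as many items as the input size \<open>?u\<close>, each of
      length at most \<open>(?u + 2) ^ c\<close>.\<close>
    obtain c where c: "\<And>i x. i \<in> S \<Longrightarrow> x \<in> set (xs i) \<Longrightarrow>
        bit_size (\<phi> i x) \<le> (bit_size (Pair (e i) (\<alpha> x)) + 2) ^ c"
      using poly_computable_size[OF assms] unfolding poly_bounded_def by auto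
    let ?u = "\<lambda>(i, j). bit_size (Pair (e i) (Pair (enc_list (map \<alpha> (xs i))) (?acc i 0)))"
    have "poly_bounded ?T ?u (\<lambda>ij. 1 + ?u ij * (1 + (?u ij + 2) ^ c))"
      by (intro poly_bounded_intros)
    then show "poly_bounded ?T ?u (\<lambda>(i, j). bit_size (?acc i j))"
    proof (rule poly_bounded_mono, clarify)
      fix i j assume i: "i \<in> S" and j: "j \<le> length (map \<alpha> (xs i))"
      have "bit_size (?acc i j) \<le> 1 + length (rev (map (\<phi> i) (take j (xs i)))) * (1 + (?u (i, j) + 2) ^ c)"
      proof (rule bit_size_enc_list_le)
        fix y assume "y \<in> set (rev (map (\<phi> i) (take j (xs i))))"
        then obtain x where x: "x \<in> set (xs i)" "y = \<phi> i x" by (auto dest: in_set_takeD)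
        have "bit_size y \<le> (bit_size (Pair (e i) (\<alpha> x)) + 2) ^ c" using c i x by simp
        also have "\<dots> \<le> (?u (i, j) + 2) ^ c"
          using bit_size_le_enc_list[of "\<alpha> x" "map \<alpha> (xs i)"] x(1) by (intro power_mono) auto
        finally show "bit_size y \<le> (?u (i, j) + 2) ^ c" .
      qed
      also have "\<dots> \<le> 1 + ?u (i, j) * (1 + (?u (i, j) + 2) ^ c)"
      proof -
        have "length (rev (map (\<phi> i) (take j (xs i)))) \<le> ?u (i, j)"
          using j length_le_bit_size_enc_list[of "map \<alpha> (xs i)"] by simp
        then show ?thesis by (intro add_left_mono mult_right_mono) auto
      qed
      finally show "bit_size (?acc i j) \<le> 1 + bit_size (Pair (e i) (Pair (enc_list (map \<alpha> (xs i))) (?acc i 0))) *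
          (1 + (bit_size (Pair (e i) (Pair (enc_list (map \<alpha> (xs i))) (?acc i 0))) + 2) ^ c)"
        by simp
    qed
  qed
  moreover have "poly_computable S (\<lambda>i. Pair (e i) (enc_list (map \<alpha> (xs i))))
      (\<lambda>i. Pair (e i) (Pair (enc_list (map \<alpha> (xs i))) (Num 0)))"
    by (intro poly_computable_Pair poly_computable_const)
      (rule poly_computable_fst poly_computable_snd, rule poly_computable_refl)+
  ultimately show ?thesis
    using poly_computable_trans by (simp, blast)
qed

text \<open>A second reversing pass, with the identity as the function and a dummy environment,
  restores the order.\<close>

lemma poly_computable_map:
  fixes xs :: "'i \<Rightarrow> 'b list" and \<alpha> :: "'b \<Rightarrow> data" and \<phi> :: "'i \<Rightarrow> 'b \<Rightarrow> data"
  assumes "poly_computable {(i, x). i \<in> S \<and> x \<in> set (xs i)} (\<lambda>(i, x). Pair (e i) (\<alpha> x)) (\<lambda>(i, x). \<phi> i x)"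
  shows "poly_computable S (\<lambda>i. Pair (e i) (enc_list (map \<alpha> (xs i)))) (\<lambda>i. enc_list (map (\<phi> i) (xs i)))"
proof -
  have "poly_computable S (\<lambda>i. Pair (e i) (enc_list (map \<alpha> (xs i))))
      (\<lambda>i. Pair (Num 0) (enc_list (rev (map (\<phi> i) (xs i)))))"
    by (intro poly_computable_Pair poly_computable_const poly_computable_map_rev assms)
  moreover have "poly_computable S (\<lambda>i. Pair (Num 0) (enc_list (rev (map (\<phi> i) (xs i)))))
      (\<lambda>i. enc_list (rev (map (\<lambda>x. x) (rev (map (\<phi> i) (xs i))))))"
    by (rule poly_computable_map_rev[where \<alpha> = "\<lambda>x. x", simplified])
      (rule poly_computable_snd_eq[OF poly_computable_refl], auto)
  ultimately show ?thesis using poly_computable_trans by (simp add: rev_map, blast)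
qed

lemma poly_computable_length:
  "poly_computable S (\<lambda>i. enc_list (xs i)) (\<lambda>i. Num (length (xs i)))"
proof -
  have "poly_computable S (\<lambda>i. Pair (Num 0) (Pair (enc_list (xs i)) (Num 0))) (\<lambda>i. Num (length (xs i)))"
  proof (rule poly_computable_fold)
    let ?B = "{(i, j). i \<in> S \<and> j < length (xs i)}"
    let ?f = "\<lambda>(i, j). Pair (Num 0) (Pair (xs i ! j) (Num j))"
    have "poly_computable ?B ?f (\<lambda>ij. Num (snd ij))"
      by (rule poly_computable_snd_eq[where g = "\<lambda>(i, j). Pair (xs i ! j) (Num j)"],
          rule poly_computable_snd_eq[OF poly_computable_refl]) auto
    from poly_computable_add[OF this poly_computable_const[of _ _ "Num 1"]]
    show "poly_computable ?B ?f (\<lambda>(i, j). Num (Suc j))"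
      by (rule poly_computable_cong) auto
  next
    have "bit_size (Num j) \<le> bit_size (enc_list (xs i)) + 1" if "j \<le> length (xs i)" for i j
      using that length_le_bit_size_enc_list[of "xs i"] bit_size_Num_le[of j] by linarith
    then show "poly_bounded {(i, j). i \<in> S \<and> j \<le> length (xs i)}
      (\<lambda>(i, j). bit_size (Pair (Num 0) (Pair (enc_list (xs i)) (Num 0)))) (\<lambda>(i, j). bit_size (Num j))"
      by (intro poly_bounded_le) (auto simp: le_SucI add.commute)
  qed
  moreover have "poly_computable S (\<lambda>i. enc_list (xs i)) (\<lambda>i. Pair (Num 0) (Pair (enc_list (xs i)) (Num 0)))"
    by (intro poly_computable_Pair poly_computable_const poly_computable_refl)
  ultimately show ?thesis using poly_computable_trans by blast
qed

section \<open>Rounding cost matrices and reference points\<close>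

lemma poly_computable_map_Num:
  assumes "poly_computable {(i, x). i \<in> S} (\<lambda>(i, x). Pair (e i) (Num x)) (\<lambda>(i, x). Num (\<phi> i x))"
  shows "poly_computable S (\<lambda>i. Pair (e i) (enc_list (map Num (xs i))))
    (\<lambda>i. enc_list (map Num (map (\<phi> i) (xs i))))"
proof -
  have "poly_computable S (\<lambda>i. Pair (e i) (enc_list (map Num (xs i))))
      (\<lambda>i. enc_list (map (\<lambda>x. Num (\<phi> i x)) (xs i)))"
    by (rule poly_computable_map, rule poly_computable_reindex[OF assms, where h = "\<lambda>x. x"]) auto
  then show ?thesis by (simp add: comp_def)
qed

lemma poly_computable_map_enc_vec:
  assumes "poly_computable {(i, x). i \<in> S} (\<lambda>(i, x). Pair (e i) (Num x)) (\<lambda>(i, x). Num (\<phi> i x))"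
  shows "poly_computable S (\<lambda>i. Pair (e i) (enc_vec (v i))) (\<lambda>i. enc_vec (map_vec (\<phi> i) (v i)))"
proof -
  have "list_of_vec (map_vec f w) = map f (list_of_vec w)" for f :: "nat \<Rightarrow> nat" and w
    by (rule nth_equalityI) (auto simp: list_of_vec_index)
  then show ?thesis
    using poly_computable_map_Num[OF assms] by (simp add: enc_vec_def)
qed

text \<open>Two nested maps: a row together with the outer index serves as the index of the inner
  map, so the environment reaches the single entries.\<close>

lemma poly_computable_map_enc_mat:
  assumes "poly_computable {(i, x). i \<in> S} (\<lambda>(i, x). Pair (e i) (Num x)) (\<lambda>(i, x). Num (\<phi> i x))"
  shows "poly_computable S (\<lambda>i. Pair (e i) (enc_mat (M i))) (\<lambda>i. enc_mat (map_mat (\<phi> i) (M i)))"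
proof -
  have map: "mat_to_list (map_mat f A) = map (map f) (mat_to_list A)" for f :: "nat \<Rightarrow> nat" and A
    by (auto simp: mat_to_list_def)
  let ?R = "{(i, r). i \<in> S \<and> r \<in> set (mat_to_list (M i))}"
  have "poly_computable ?R (\<lambda>ir. Pair (e (fst ir)) (enc_list (map Num (snd ir))))
      (\<lambda>ir. enc_list (map Num (map (\<phi> (fst ir)) (snd ir))))"
    by (rule poly_computable_map_Num,
        rule poly_computable_reindex[OF assms, where h = "\<lambda>((i, r), x). (i, x)"]) auto
  then have "poly_computable ?R (\<lambda>(i, r). Pair (e i) (enc_list (map Num r)))
      (\<lambda>(i, r). enc_list (map Num (map (\<phi> i) r)))"
    by (rule poly_computable_cong) auto
  then have "poly_computable S (\<lambda>i. Pair (e i) (enc_list (map (\<lambda>r. enc_list (map Num r)) (mat_to_list (M i)))))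
      (\<lambda>i. enc_list (map (\<lambda>r. enc_list (map Num (map (\<phi> i) r))) (mat_to_list (M i))))"
    by (rule poly_computable_map)
  then show ?thesis by (simp add: enc_mat_def map comp_def)
qed

lemma poly_computable_dim_row: "poly_computable S (\<lambda>i. enc_mat (M i)) (\<lambda>i. Num (dim_row (M i)))"
  using poly_computable_length[of S "\<lambda>i. map (\<lambda>row. enc_list (map Num row)) (mat_to_list (M i))"]
  by (simp add: enc_mat_def mat_to_list_def)

text \<open>The encoding shows the number of columns only as the length of a row, here the first
  one; without rows it would be lost.\<close>

lemma poly_computable_dim_col:
  assumes "\<And>i. i \<in> S \<Longrightarrow> dim_row (M i) > 0"
  shows "poly_computable S (\<lambda>i. enc_mat (M i)) (\<lambda>i. Num (dim_col (M i)))"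
proof -
  let ?r = "\<lambda>i. map Num (hd (mat_to_list (M i)))"
  have "poly_computable S (\<lambda>i. enc_mat (M i)) (\<lambda>i. enc_list (?r i))"
  proof (rule poly_computable_fst_eq[OF poly_computable_refl])
    fix i assume "i \<in> S"
    then have "mat_to_list (M i) \<noteq> []" using assms by (auto simp: mat_to_list_def)
    then show "\<exists>y. enc_mat (M i) = Pair (enc_list (?r i)) y"
      by (cases "mat_to_list (M i)") (auto simp: enc_mat_def)
  qed
  moreover have "poly_computable S (\<lambda>i. enc_list (?r i)) (\<lambda>i. Num (dim_col (M i)))"
    by (rule poly_computable_cong[OF poly_computable_length])
      (use assms in \<open>auto simp: mat_to_list_def upt_conv_Cons\<close>)
  ultimately show ?thesis by (rule poly_computable_trans)
qed

text \<open>The ceiling of \<open>c * K / a\<close> in natural arithmetic. With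
  \<open>K = m * error_count C * b\<close> and L = a / b, the quotient a / K is the unit D in which
  costs are measured.\<close>

definition round_up :: "nat \<Rightarrow> nat \<Rightarrow> nat \<Rightarrow> nat" where
  "round_up K a c = (c * K + (a - 1)) div a"

definition round_down :: "nat \<Rightarrow> nat \<Rightarrow> nat \<Rightarrow> nat" where
  "round_down K a c = c * K div a"

lemma round_up_bounds:
  assumes "a > 0"
  shows "real K / real a * real c \<le> real (round_up K a c)"
    and "real (round_up K a c) \<le> real K / real a * real c + 1"
proof -
  let ?q = "round_up K a c"
  have "c * K \<le> ?q * a"
    using div_mult_mod_eq[of "c * K + (a - 1)" a] mod_less_divisor[OF assms, of "c * K + (a - 1)"]
    unfolding round_up_def by linarith
  then have "real c * real K \<le> real ?q * real a"
    unfolding of_nat_mult[symmetric] of_nat_le_iff .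
  then show "real K / real a * real c \<le> real ?q"
    using assms by (simp add: field_simps)
  have "?q * a \<le> c * K + (a - 1)"
    unfolding round_up_def by (simp add: mult.commute)
  then have "?q * a \<le> c * K + a" by linarith
  then have "real ?q * real a \<le> real c * real K + real a"
    unfolding of_nat_mult[symmetric] of_nat_add[symmetric] of_nat_le_iff .
  then show "real ?q \<le> real K / real a * real c + 1"
    using assms by (simp add: field_simps)
qed

lemma round_down_bounds:
  assumes "a > 0"
  shows "real (round_down K a c) \<le> real K / real a * real c"
    and "real K / real a * real c - 1 \<le> real (round_down K a c)"
proof -
  let ?q = "round_down K a c"
  have "?q * a \<le> c * K"
    unfolding round_down_def by (simp add: mult.commute)
  then have "real ?q * real a \<le> real c * real K"
    unfolding of_nat_mult[symmetric] of_nat_le_iff .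
  then show "real ?q \<le> real K / real a * real c"
    using assms by (simp add: field_simps)
  have "c * K \<le> ?q * a + a"
    using div_mult_mod_eq[of "c * K" a] mod_less_divisor[OF assms, of "c * K"]
    unfolding round_down_def by linarith
  then have "real c * real K \<le> real ?q * real a + real a"
    unfolding of_nat_mult[symmetric] of_nat_add[symmetric] of_nat_le_iff .
  then show "real K / real a * real c - 1 \<le> real ?q"
    using assms by (simp add: field_simps)
qed

lemma
  shows poly_computable_round_up: "poly_computable {(i, x). i \<in> S}
      (\<lambda>(i, x). Pair (Pair (Num (K i)) (Num (a i))) (Num x)) (\<lambda>(i, x). Num (round_up (K i) (a i) x))"
    and poly_computable_round_down: "poly_computable {(i, x). i \<in> S}
      (\<lambda>(i, x). Pair (Pair (Num (K i)) (Num (a i))) (Num x)) (\<lambda>(i, x). Num (round_down (K i) (a i) x))"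
proof -
  let ?T = "{(i, x :: nat). i \<in> S}"
  let ?f = "\<lambda>ix. Pair (Pair (Num (K (fst ix))) (Num (a (fst ix)))) (Num (snd ix))"
  have x: "poly_computable ?T ?f (\<lambda>ix. Num (snd ix))"
    and Ka: "poly_computable ?T ?f (\<lambda>ix. Pair (Num (K (fst ix))) (Num (a (fst ix))))"
    by (rule poly_computable_fst poly_computable_snd, rule poly_computable_refl)+
  have up: "poly_computable ?T ?f (\<lambda>ix. Num (round_up (K (fst ix)) (a (fst ix)) (snd ix)))"
    unfolding round_up_def
    by (intro poly_computable_div poly_computable_add poly_computable_mult poly_computable_diff
        poly_computable_const x poly_computable_fst[OF Ka] poly_computable_snd[OF Ka])
  have down: "poly_computable ?T ?f (\<lambda>ix. Num (round_down (K (fst ix)) (a (fst ix)) (snd ix)))"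
    unfolding round_down_def
    by (intro poly_computable_div poly_computable_mult
        x poly_computable_fst[OF Ka] poly_computable_snd[OF Ka])
  show "poly_computable ?T (\<lambda>(i, x). Pair (Pair (Num (K i)) (Num (a i))) (Num x))
      (\<lambda>(i, x). Num (round_up (K i) (a i) x))"
    by (rule poly_computable_cong[OF up]) auto
  show "poly_computable ?T (\<lambda>(i, x). Pair (Pair (Num (K i)) (Num (a i))) (Num x))
      (\<lambda>(i, x). Num (round_down (K i) (a i) x))"
    by (rule poly_computable_cong[OF down]) auto
qed

text \<open>
  Bounds the rounding error \<open>k n + n + 2\<close> of the objective: \<open>k n\<close> in the sum of the entries of
  \<open>C x\<close>, \<open>n\<close> in the maximum of \<open>C x - ybar\<close>, and \<open>1\<close> for each occurrence of \<open>ybar\<close> in a maximum.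
\<close>

definition error_count :: "nat mat \<Rightarrow> nat" where
  "error_count C = (dim_row C + 1) * (dim_col C + 2)"

text \<open>The description is kept, and with it the feasible set. As a description admits every
  cost matrix of its dimensions, the exact algorithm applies to the result, and its solutions need
  no translation back.\<close>

definition scaled_instance :: "nat \<Rightarrow> nat \<Rightarrow> mc_instance \<Rightarrow> mc_instance" where
  "scaled_instance K a I = (fst I, map_mat (round_up K a) (snd I))"

lemma poly_computable_scaled_input:
  assumes "\<And>i. i \<in> S \<Longrightarrow> dim_row (snd (I i)) > 0"
    and f: "poly_computable S f (\<lambda>i. enc_input (I i) (ybar i))"
    and m: "poly_computable S f (\<lambda>i. Num (m i))"
    and a: "poly_computable S f (\<lambda>i. Num (a i))" and b: "poly_computable S f (\<lambda>i. Num (b i))"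
    and K: "\<And>i. i \<in> S \<Longrightarrow> K i = m i * error_count (snd (I i)) * b i"
  shows "poly_computable S f
    (\<lambda>i. enc_input (scaled_instance (K i) (a i) (I i)) (map_vec (round_down (K i) (a i)) (ybar i)))"
proof -
  have y: "poly_computable S f (\<lambda>i. enc_vec (ybar i))"
    and I: "poly_computable S f (\<lambda>i. Pair (fst (I i)) (enc_mat (snd (I i))))"
    using f unfolding enc_input_def enc_instance_def
    by (auto elim: poly_computable_fst poly_computable_snd)
  note s = poly_computable_fst[OF I] and C = poly_computable_snd[OF I]
  have "poly_computable S f (\<lambda>i. Num (m i * ((dim_row (snd (I i)) + 1) * (dim_col (snd (I i)) + 2)) * b i))"
    by (intro poly_computable_mult poly_computable_add poly_computable_const m b
        poly_computable_trans[OF C poly_computable_dim_row]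
        poly_computable_trans[OF C poly_computable_dim_col] assms(1))
  then have "poly_computable S f (\<lambda>i. Num (K i))"
    by (rule poly_computable_cong) (auto simp: K error_count_def)
  then have e: "poly_computable S f (\<lambda>i. Pair (Num (K i)) (Num (a i)))"
    using a by (rule poly_computable_Pair)
  have "poly_computable S f (\<lambda>i. enc_mat (map_mat (round_up (K i) (a i)) (snd (I i))))"
    using poly_computable_Pair[OF e C] poly_computable_map_enc_mat[OF poly_computable_round_up]
    by (rule poly_computable_trans)
  moreover have "poly_computable S f (\<lambda>i. enc_vec (map_vec (round_down (K i) (a i)) (ybar i)))"
    using poly_computable_Pair[OF e y] poly_computable_map_enc_vec[OF poly_computable_round_down]
    by (rule poly_computable_trans)
  ultimately show ?thesis
    unfolding enc_input_def enc_instance_def scaled_instance_def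
    by (simp add: poly_computable_Pair s)
qed

section \<open>The objective under rounding\<close>

lemma Max_image_le_affine:
  fixes f g :: "nat \<Rightarrow> real"
  assumes "finite A" "A \<noteq> {}" "0 \<le> \<rho>" and "\<And>i. i \<in> A \<Longrightarrow> f i \<le> \<rho> * g i + c"
  shows "Max (f ` A) \<le> \<rho> * Max (g ` A) + c"
proof -
  have "f i \<le> \<rho> * Max (g ` A) + c" if "i \<in> A" for i
  proof -
    have "g i \<le> Max (g ` A)" using assms(1) that by simp
    then show ?thesis using assms(4)[OF that] mult_left_mono[OF _ assms(3)] by fastforce
  qed
  then show ?thesis using assms(1,2) by simp
qed

text \<open>The coefficient 1/p with the convention 1/\<infinity> = 0, which merges the two cases of
  the norm into one formula.\<close>

definition sum_weight :: "ereal \<Rightarrow> real" where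
  "sum_weight p = (if p = \<infinity> then 0 else 1 / real_of_ereal p)"

lemma sum_weight_bounds:
  assumes "1 \<le> p"
  shows "0 \<le> sum_weight p" and "sum_weight p \<le> 1"
proof -
  have "0 \<le> sum_weight p \<and> sum_weight p \<le> 1"
    using assms by (cases p) (auto simp: sum_weight_def one_ereal_def)
  then show "0 \<le> sum_weight p" and "sum_weight p \<le> 1" by auto
qed

text \<open>For \<open>ybar \<le> y\<close> the absolute values disappear, and the weighted sums
  over \<open>ybar\<close> and over \<open>y - ybar\<close> add up to one over \<open>y\<close>.
  Rounding \<open>ybar\<close> therefore affects the two maxima only.\<close>

lemma ref_obj_eq:
  assumes "ybar \<in> carrier_vec k" "y \<in> carrier_vec k" and "\<And>i. i < k \<Longrightarrow> ybar $ i \<le> y $ i"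
  shows "ref_obj p ybar y = Max ((\<lambda>i. real (ybar $ i)) ` {..<k})
    + Max ((\<lambda>i. real (y $ i) - real (ybar $ i)) ` {..<k}) + sum_weight p * (\<Sum>i<k. real (y $ i))"
proof -
  have norm: "cornered_norm p v = Max ((\<lambda>i. \<bar>v $ i\<bar>) ` {..<dim_vec v})
      + sum_weight p * (\<Sum>i<dim_vec v. \<bar>v $ i\<bar>)" for v
    by (simp add: cornered_norm_def sum_weight_def)
  have abs: "\<bar>(map_vec real y - map_vec real ybar) $ i\<bar> = real (y $ i) - real (ybar $ i)"
    "\<bar>map_vec real ybar $ i\<bar> = real (ybar $ i)" if "i < k" for i
    using assms that by auto
  have "ref_obj p ybar y = Max ((\<lambda>i. real (ybar $ i)) ` {..<k})
    + sum_weight p * (\<Sum>i<k. real (ybar $ i))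
    + (Max ((\<lambda>i. real (y $ i) - real (ybar $ i)) ` {..<k})
      + sum_weight p * (\<Sum>i<k. real (y $ i) - real (ybar $ i)))"
    unfolding ref_obj_def norm using assms(1,2) abs
    by (simp cong: image_cong_simp del: index_map_vec(1) index_minus_vec(1))
  then show ?thesis by (simp add: sum_subtractf algebra_simps)
qed

lemma ref_obj_nonneg:
  assumes "1 \<le> p" "0 < k" "ybar \<in> carrier_vec k" "y \<in> carrier_vec k" "\<And>i. i < k \<Longrightarrow> ybar $ i \<le> y $ i"
  shows "0 \<le> ref_obj p ybar y"
proof -
  have "0 \<le> Max (f ` {..<k})" if "\<And>i. i < k \<Longrightarrow> (0 :: real) \<le> f i" for f
    by (rule order_trans[OF that[OF assms(2)]]) (use assms(2) in simp)
  moreover have "0 \<le> sum_weight p * (\<Sum>i<k. real (y $ i))"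
    using sum_weight_bounds(1)[OF assms(1)] by (simp add: sum_nonneg)
  ultimately show ?thesis
    using assms(5) by (subst ref_obj_eq[OF assms(3,4)]) (auto intro!: add_nonneg_nonneg)
qed

text \<open>Upwards, the maximum of \<open>ybar\<close> does not grow, the maximal difference grows
  by at most \<open>n + 1\<close>, and the weighted sum by at most \<open>k * n\<close> as its
  weight is at most 1. Downwards, differences and sum cannot shrink, since \<open>y\<close> is
  rounded up and \<open>ybar\<close> down; only the maximum of \<open>ybar\<close> can lose
  1.\<close>

lemma ref_obj_scaling:
  fixes n k :: nat and \<rho> :: real
  assumes "1 \<le> p" "0 < k" "0 \<le> \<rho>"
    and "ybar \<in> carrier_vec k" "y \<in> carrier_vec k" "ybar' \<in> carrier_vec k" "y' \<in> carrier_vec k"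
    and le: "\<And>i. i < k \<Longrightarrow> ybar $ i \<le> y $ i" and le': "\<And>i. i < k \<Longrightarrow> ybar' $ i \<le> y' $ i"
    and y: "\<And>i. i < k \<Longrightarrow> \<rho> * real (y $ i) \<le> real (y' $ i)"
      "\<And>i. i < k \<Longrightarrow> real (y' $ i) \<le> \<rho> * real (y $ i) + real n"
    and ybar: "\<And>i. i < k \<Longrightarrow> real (ybar' $ i) \<le> \<rho> * real (ybar $ i)"
      "\<And>i. i < k \<Longrightarrow> \<rho> * real (ybar $ i) - 1 \<le> real (ybar' $ i)"
  shows "ref_obj p ybar' y' \<le> \<rho> * ref_obj p ybar y + real (k * n + n + 1)"
    and "\<rho> * ref_obj p ybar y \<le> ref_obj p ybar' y' + 1"
proof -
  let ?A = "{..<k}" and ?w = "sum_weight p"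
  let ?b = "\<lambda>i. real (ybar $ i)" and ?b' = "\<lambda>i. real (ybar' $ i)"
  let ?d = "\<lambda>i. real (y $ i) - real (ybar $ i)" and ?d' = "\<lambda>i. real (y' $ i) - real (ybar' $ i)"
  let ?s = "\<Sum>i<k. real (y $ i)" and ?s' = "\<Sum>i<k. real (y' $ i)"
  have A: "finite ?A" "?A \<noteq> {}" using assms(2) by auto
  note w = sum_weight_bounds[OF assms(1)]
  have eqs: "ref_obj p ybar y = Max (?b ` ?A) + Max (?d ` ?A) + ?w * ?s"
    "ref_obj p ybar' y' = Max (?b' ` ?A) + Max (?d' ` ?A) + ?w * ?s'"
    using assms(4-7) le le' by (simp_all add: ref_obj_eq)
  have "Max (?b' ` ?A) \<le> \<rho> * Max (?b ` ?A) + 0"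
    using A assms(3) by (rule Max_image_le_affine) (use ybar in auto)
  moreover have "Max (?d' ` ?A) \<le> \<rho> * Max (?d ` ?A) + (real n + 1)"
    using A assms(3)
  proof (rule Max_image_le_affine)
    fix i assume "i \<in> ?A"
    then show "?d' i \<le> \<rho> * ?d i + (real n + 1)"
      using y(2)[of i] ybar(2)[of i] by (simp add: algebra_simps)
  qed
  moreover have "?w * ?s' \<le> \<rho> * (?w * ?s) + real (k * n)"
  proof -
    have "?s' \<le> (\<Sum>i<k. \<rho> * real (y $ i) + real n)" by (intro sum_mono y) auto
    also have "\<dots> = \<rho> * ?s + real (k * n)" by (simp add: sum.distrib sum_distrib_left)
    finally have "?w * ?s' \<le> ?w * (\<rho> * ?s + real (k * n))" using w(1) by (rule mult_left_mono)
    moreover have "?w * real (k * n) \<le> 1 * real (k * n)" using w(2) by (rule mult_right_mono) simp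
    ultimately show ?thesis by (simp add: algebra_simps)
  qed
  ultimately show "ref_obj p ybar' y' \<le> \<rho> * ref_obj p ybar y + real (k * n + n + 1)"
    unfolding eqs by (simp add: distrib_left)
  \<comment> \<open>In the reverse estimate \<rho> stands on the smaller side, so it is moved inside
    the maxima and the affine bound is applied with factor 1.\<close>
  have Max_mult: "\<rho> * Max (g ` ?A) = Max ((\<lambda>i. \<rho> * g i) ` ?A)" for g
    using mono_Max_commute[of "\<lambda>x. \<rho> * x" "g ` ?A"] assms(3) A
    by (simp add: mono_def mult_left_mono image_image)
  have "Max ((\<lambda>i. \<rho> * ?b i) ` ?A) \<le> 1 * Max (?b' ` ?A) + 1"
    using A by (rule Max_image_le_affine) (use ybar(2) in \<open>force simp: algebra_simps\<close>)+
  moreover have "Max ((\<lambda>i. \<rho> * ?d i) ` ?A) \<le> 1 * Max (?d' ` ?A) + 0"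
    using A
  proof (rule Max_image_le_affine)
    fix i assume "i \<in> ?A"
    then show "\<rho> * ?d i \<le> 1 * ?d' i + 0"
      using y(1)[of i] ybar(1)[of i] by (simp add: algebra_simps)
  qed simp
  moreover have "?w * (\<rho> * ?s) \<le> ?w * ?s'"
    by (rule mult_left_mono[OF _ w(1)]) (auto simp: sum_distrib_left intro!: sum_mono y)
  ultimately have "\<rho> * Max (?b ` ?A) + \<rho> * Max (?d ` ?A) + ?w * (\<rho> * ?s)
      \<le> Max (?b' ` ?A) + Max (?d' ` ?A) + ?w * ?s' + 1"
    unfolding Max_mult by linarith
  then show "\<rho> * ref_obj p ybar y \<le> ref_obj p ybar' y' + 1"
    unfolding eqs distrib_left by (simp only: mult.left_commute)
qed

section \<open>Costs, reference points and optimal values of rounded instances\<close>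

lemma cost_carrier: "snd I \<in> carrier_mat k n \<Longrightarrow> cost I x \<in> carrier_vec k"
  by (rule carrier_vecI) (simp add: cost_def)

lemma cost_nth:
  assumes "snd I \<in> carrier_mat k n" "x \<in> carrier_vec n" "i < k"
  shows "cost I x $ i = (\<Sum>j<n. snd I $$ (i, j) * x $ j)"
proof -
  have "dim_row (snd I) = k" "dim_col (snd I) = n" "dim_vec x = n" using assms by auto
  then show ?thesis
    using assms(3) by (simp add: cost_def scalar_prod_def atLeast0LessThan)
qed

text \<open>A solution is binary, so row \<open>i\<close> gains less than or exactly one unit per
  selected variable, hence at most \<open>n\<close> in total.\<close>

lemma cost_rounded_bounds:
  assumes C: "snd I \<in> carrier_mat k n" and x: "x \<in> carrier_vec n" "\<And>j. j < n \<Longrightarrow> x $ j \<in> {0, 1}"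
    and i: "i < k" and a: "0 < a"
  shows "real K / real a * real (cost I x $ i) \<le> real (cost (scaled_instance K a I) x $ i)"
    and "real (cost (scaled_instance K a I) x $ i) \<le> real K / real a * real (cost I x $ i) + real n"
proof -
  have C': "snd (scaled_instance K a I) \<in> carrier_mat k n" using C by (simp add: scaled_instance_def)
  have eq: "cost (scaled_instance K a I) x $ i = (\<Sum>j<n. round_up K a (snd I $$ (i, j)) * x $ j)"
    using C i unfolding cost_nth[OF C' x(1) i] by (intro sum.cong) (auto simp: scaled_instance_def)
  have "real K / real a * real (snd I $$ (i, j) * x $ j) \<le> real (round_up K a (snd I $$ (i, j)) * x $ j)"
    and "real (round_up K a (snd I $$ (i, j)) * x $ j) \<le> real K / real a * real (snd I $$ (i, j) * x $ j) + 1"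
    if "j < n" for j
    using x(2)[OF that] round_up_bounds[OF a, where K = K and c = "snd I $$ (i, j)"]
    by auto
  then show "real K / real a * real (cost I x $ i) \<le> real (cost (scaled_instance K a I) x $ i)"
    and "real (cost (scaled_instance K a I) x $ i) \<le> real K / real a * real (cost I x $ i) + real n"
    unfolding eq cost_nth[OF C x(1) i] of_nat_sum sum_distrib_left
    using sum_mono[of "{..<n}" "\<lambda>j. real (round_up K a (snd I $$ (i, j)) * x $ j)"
        "\<lambda>j. real K / real a * real (snd I $$ (i, j) * x $ j) + 1"]
    by (auto simp: sum.distrib intro!: sum_mono)
qed

text \<open>Makes the minima in \<open>ideal_point\<close> and \<open>opt_val\<close> attained
  minima over finite sets.\<close>

lemma finite_binary_vecs: "finite {x \<in> carrier_vec n. \<forall>j<n. x $ j \<in> {0 :: nat, 1}}"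
proof (rule finite_subset)
  show "{x \<in> carrier_vec n. \<forall>j<n. x $ j \<in> {0 :: nat, 1}}
      \<subseteq> vec_of_list ` {xs. set xs \<subseteq> {0, 1} \<and> length xs = n}"
  proof
    fix x assume x: "x \<in> {x \<in> carrier_vec n. \<forall>j<n. x $ j \<in> {0 :: nat, 1}}"
    have "set (list_of_vec x) \<subseteq> {0, 1}" "length (list_of_vec x) = n"
      using x by (auto simp: set_conv_nth list_of_vec_index)
    then show "x \<in> vec_of_list ` {xs. set xs \<subseteq> {0, 1} \<and> length xs = n}"
      by (intro image_eqI[of _ _ "list_of_vec x"]) (auto simp: vec_list)
  qed
qed (simp add: finite_lists_length_eq)

lemma
  assumes "multicriteria_problem P" "I \<in> instances P"
  shows finite_solutions: "finite (solutions P I)"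
    and solutions_nonempty: "solutions P I \<noteq> {}"
    and solutions_binary: "x \<in> solutions P I \<Longrightarrow> x \<in> carrier_vec (num_vars P (fst I))"
      "x \<in> solutions P I \<Longrightarrow> j < num_vars P (fst I) \<Longrightarrow> x $ j \<in> {0, 1}"
    and num_crit_pos: "num_crit P (fst I) > 0"
    and instance_carrier: "snd I \<in> carrier_mat (num_crit P (fst I)) (num_vars P (fst I))"
proof -
  obtain s C where I: "I = (s, C)" "s \<in> descriptions P"
    "C \<in> carrier_mat (num_crit P s) (num_vars P s)"
    using assms(2) by (auto simp: instances_def)
  have *: "num_crit P s \<ge> 1" "feasible P s \<noteq> {}"
    "feasible P s \<subseteq> {x \<in> carrier_vec (num_vars P s). \<forall>j<num_vars P s. x $ j \<in> {0, 1}}"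
    using assms(1) I(2) unfolding multicriteria_problem_def by blast+
  show "finite (solutions P I)" "solutions P I \<noteq> {}" "num_crit P (fst I) > 0"
    "snd I \<in> carrier_mat (num_crit P (fst I)) (num_vars P (fst I))"
    using * I finite_subset[OF *(3) finite_binary_vecs] by (auto simp: solutions_def)
  show "x \<in> carrier_vec (num_vars P (fst I))" if "x \<in> solutions P I"
    using that * I by (auto simp: solutions_def)
  show "x $ j \<in> {0, 1}" if "x \<in> solutions P I" "j < num_vars P (fst I)"
    using subsetD[OF *(3), of x] that I(1) by (simp add: solutions_def)
qed

lemma reference_points_iff:
  assumes "multicriteria_problem P" "I \<in> instances P"
  shows "ybar \<in> reference_points P I \<longleftrightarrow> ybar \<in> carrier_vec (num_crit P (fst I)) \<and>
    (\<forall>i<num_crit P (fst I). \<forall>x\<in>solutions P I. ybar $ i \<le> cost I x $ i)"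
proof -
  have "(m \<le> Min ((\<lambda>x. cost I x $ i) ` solutions P I)) \<longleftrightarrow> (\<forall>x\<in>solutions P I. m \<le> cost I x $ i)" for m i
    using finite_solutions[OF assms] solutions_nonempty[OF assms] by simp
  then show ?thesis by (simp add: reference_points_def ideal_point_def)
qed

lemma scaled_instance_in_instances: "I \<in> instances P \<Longrightarrow> scaled_instance K a I \<in> instances P"
  by (auto simp: instances_def scaled_instance_def)

lemma solutions_scaled_instance [simp]: "solutions P (scaled_instance K a I) = solutions P I"
  by (simp add: solutions_def scaled_instance_def)

lemma fst_scaled_instance [simp]: "fst (scaled_instance K a I) = fst I"
  by (simp add: scaled_instance_def)

lemma round_down_in_reference_points:
  assumes P: "multicriteria_problem P" and I: "I \<in> instances P" and y: "ybar \<in> reference_points P I"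
    and a: "0 < a"
  shows "map_vec (round_down K a) ybar \<in> reference_points P (scaled_instance K a I)"
proof -
  let ?k = "num_crit P (fst I)"
  have y': "ybar \<in> carrier_vec ?k" "\<And>i x. i < ?k \<Longrightarrow> x \<in> solutions P I \<Longrightarrow> ybar $ i \<le> cost I x $ i"
    using y unfolding reference_points_iff[OF P I] by auto
  have "round_down K a (ybar $ i) \<le> cost (scaled_instance K a I) x $ i"
    if i: "i < ?k" and x: "x \<in> solutions P I" for i x
  proof -
    have "real (round_down K a (ybar $ i)) \<le> real K / real a * real (ybar $ i)"
      by (rule round_down_bounds(1)[OF a])
    also have "\<dots> \<le> real K / real a * real (cost I x $ i)"
      using y'(2)[OF i x] by (intro mult_left_mono) auto
    also have "\<dots> \<le> real (cost (scaled_instance K a I) x $ i)"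
      by (rule cost_rounded_bounds(1)[OF instance_carrier[OF P I] solutions_binary[OF P I x] i a])
    finally show ?thesis by simp
  qed
  then show ?thesis
    unfolding reference_points_iff[OF P scaled_instance_in_instances[OF I]] using y'(1) by auto
qed

text \<open>Both estimates carry \<open>r' + 1\<close>, so that comparing two solutions through
  their rounded values costs exactly one \<open>error_count\<close>.\<close>

lemma ref_obj_scaled_instance:
  fixes K :: nat
  assumes P: "multicriteria_problem P" and p: "1 \<le> p"
    and I: "I \<in> instances P" and y: "ybar \<in> reference_points P I"
    and a: "0 < a" and x: "x \<in> solutions P I"
  defines "r \<equiv> ref_obj p ybar (cost I x)"
    and "r' \<equiv> ref_obj p (map_vec (round_down K a) ybar) (cost (scaled_instance K a I) x)"
  shows "r' + 1 \<le> real K / real a * r + real (error_count (snd I))"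
    and "real K / real a * r \<le> r' + 1"
proof -
  let ?k = "num_crit P (fst I)" and ?n = "num_vars P (fst I)"
  note C = instance_carrier[OF P I]
  note C' = instance_carrier[OF P scaled_instance_in_instances[OF I], of K a]
  have y1: "ybar \<in> carrier_vec ?k" "\<And>i. i < ?k \<Longrightarrow> ybar $ i \<le> cost I x $ i"
    using y x unfolding reference_points_iff[OF P I] by auto
  have y2: "map_vec (round_down K a) ybar \<in> carrier_vec ?k"
    "\<And>i. i < ?k \<Longrightarrow> map_vec (round_down K a) ybar $ i \<le> cost (scaled_instance K a I) x $ i"
    using round_down_in_reference_points[OF P I y a, of K] x
    unfolding reference_points_iff[OF P scaled_instance_in_instances[OF I]] by auto
  note c = cost_rounded_bounds[OF C solutions_binary[OF P I x] _ a, of _ K]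
  have d: "real (map_vec (round_down K a) ybar $ i) \<le> real K / real a * real (ybar $ i)"
    "real K / real a * real (ybar $ i) - 1 \<le> real (map_vec (round_down K a) ybar $ i)" if "i < ?k" for i
    using round_down_bounds[OF a, where K = K and c = "ybar $ i"] y1(1) that by auto
  have \<rho>: "0 \<le> real K / real a" by simp
  have "r' \<le> real K / real a * r + real (?k * ?n + ?n + 1)" "real K / real a * r \<le> r' + 1"
    unfolding r_def r'_def
    by (rule ref_obj_scaling[OF p num_crit_pos[OF P I] \<rho> y1(1) cost_carrier[OF C] y2(1)
          cost_carrier[OF C'[unfolded fst_scaled_instance]] y1(2) y2(2) c d]; assumption)+
  \<comment> \<open>The second 1 is the loss of the reverse estimate, charged here in
    advance.\<close>
  moreover have "?k * ?n + ?n + 1 + 1 \<le> error_count (snd I)"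
    using C by (auto simp: error_count_def)
  ultimately show "r' + 1 \<le> real K / real a * r + real (error_count (snd I))"
    and "real K / real a * r \<le> r' + 1" by linarith+
qed

lemma
  assumes "multicriteria_problem P" "I \<in> instances P"
  shows opt_val_le: "x \<in> solutions P I \<Longrightarrow> opt_val P p I ybar \<le> ref_obj p ybar (cost I x)"
    and opt_val_attained: "\<exists>x\<in>solutions P I. ref_obj p ybar (cost I x) = opt_val P p I ybar"
proof -
  let ?V = "(\<lambda>x. ref_obj p ybar (cost I x)) ` solutions P I"
  have V: "finite ?V" "?V \<noteq> {}" using finite_solutions[OF assms] solutions_nonempty[OF assms] by auto
  show "opt_val P p I ybar \<le> ref_obj p ybar (cost I x)" if "x \<in> solutions P I"
    unfolding opt_val_def using V(1) that by simp
  show "\<exists>x\<in>solutions P I. ref_obj p ybar (cost I x) = opt_val P p I ybar"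
    unfolding opt_val_def using Min_in[OF V] by auto
qed

lemma opt_val_nonneg:
  assumes "multicriteria_problem P" "1 \<le> p" "I \<in> instances P" "ybar \<in> reference_points P I"
  shows "0 \<le> opt_val P p I ybar"
proof -
  obtain x where x: "x \<in> solutions P I" "ref_obj p ybar (cost I x) = opt_val P p I ybar"
    using opt_val_attained[OF assms(1,3)] by blast
  have "0 \<le> ref_obj p ybar (cost I x)"
    by (rule ref_obj_nonneg[OF assms(2) num_crit_pos[OF assms(1,3)]])
      (use assms(4) x(1) cost_carrier[OF instance_carrier[OF assms(1,3)]] in
        \<open>auto simp: reference_points_iff[OF assms(1,3)]\<close>)
  then show ?thesis using x(2) by simp
qed

lemma error_count_pos: "0 < error_count C"
  by (simp add: error_count_def)

text \<open>Accuracy follows from the chain \<rho> r(x) \<le> opt' + 1 \<le> \<rho> opt + N, where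
  \<rho> = K / a and opt' is the rounded optimum; a lower bound below opt turns the absolute error
  into a relative one. In the bound on opt' the quotient a / b cancels against \<rho>, so the
  magnitude of the costs disappears.\<close>

lemma
  fixes a b m K :: nat
  assumes P: "multicriteria_problem P" and p: "1 \<le> p"
    and I: "I \<in> instances P" and y: "ybar \<in> reference_points P I"
    and pos: "0 < a" "0 < b" "0 < m" and K: "K = m * error_count (snd I) * b"
  defines "I' \<equiv> scaled_instance K a I" and "y' \<equiv> map_vec (round_down K a) ybar"
  shows scaled_solution_accuracy: "x \<in> solutions P I \<Longrightarrow>
      ref_obj p y' (cost I' x) = opt_val P p I' y' \<Longrightarrow>
      real a / real b \<le> opt_val P p I ybar \<Longrightarrow>
      ref_obj p ybar (cost I x) \<le> (1 + 1 / real m) * opt_val P p I ybar"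
    and scaled_opt_val_bound: "opt_val P p I ybar \<le> c * (real a / real b) \<Longrightarrow>
      opt_val P p I' y' \<le> real (error_count (snd I)) * (real m * c + 1)"
proof -
  let ?N = "real (error_count (snd I))" and ?\<rho> = "real K / real a" and ?opt = "opt_val P p I ybar"
  have N: "0 < ?N" using error_count_pos by simp
  have \<rho>: "?\<rho> = real m * ?N * real b / real a" using K by simp
  have \<rho>0: "0 < ?\<rho>" using N pos unfolding \<rho> by simp
  have I': "I' \<in> instances P" unfolding I'_def using I by (rule scaled_instance_in_instances)
  note bnd = ref_obj_scaled_instance[OF P p I y pos(1), of _ K, folded I'_def y'_def]
  obtain z where z: "z \<in> solutions P I" "ref_obj p ybar (cost I z) = ?opt"
    using opt_val_attained[OF P I] by blast
  have "opt_val P p I' y' \<le> ref_obj p y' (cost I' z)"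
    using opt_val_le[OF P I'] z(1) by (simp add: I'_def)
  then have opt': "opt_val P p I' y' + 1 \<le> ?\<rho> * ?opt + ?N"
    using bnd(1)[OF z(1)] z(2) by simp
  show "ref_obj p ybar (cost I x) \<le> (1 + 1 / real m) * ?opt"
    if x: "x \<in> solutions P I" "ref_obj p y' (cost I' x) = opt_val P p I' y'"
      and L: "real a / real b \<le> ?opt"
  proof -
    have "?\<rho> * ref_obj p ybar (cost I x) \<le> ?\<rho> * ?opt + ?N"
      using bnd(2)[OF x(1)] x(2) opt' by simp
    \<comment> \<open>This is what \<open>K\<close> is chosen for: N rounded units are worth exactly
      a / (b m) in the original scale.\<close>
    also have "?N = ?\<rho> * (real a / real b / real m)"
      using pos unfolding \<rho> by simp
    finally have "?\<rho> * ref_obj p ybar (cost I x) \<le> ?\<rho> * (?opt + real a / real b / real m)"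
      by (simp add: distrib_left)
    then have "ref_obj p ybar (cost I x) \<le> ?opt + real a / real b / real m"
      using \<rho>0 by (simp only: mult_le_cancel_left_pos)
    also have "\<dots> \<le> ?opt + ?opt / real m"
      using L by (intro add_left_mono divide_right_mono) auto
    finally show ?thesis by (simp add: algebra_simps)
  qed
  show "opt_val P p I' y' \<le> ?N * (real m * c + 1)" if U: "?opt \<le> c * (real a / real b)"
  proof -
    have "?\<rho> * ?opt \<le> ?\<rho> * (c * (real a / real b))"
      using U \<rho>0 by (intro mult_left_mono) auto
    also have "\<dots> = ?N * (real m * c)"
      using pos unfolding \<rho> by simp
    finally show ?thesis using opt' by (simp add: distrib_left)
  qed
qed

section \<open>Encoding lengths\<close>

lemma bit_size_enc_list_mono:
  "list_all2 (\<lambda>x y. bit_size x \<le> bit_size y) xs ys \<Longrightarrow> bit_size (enc_list xs) \<le> bit_size (enc_list ys)"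
  by (induction rule: list_all2_induct) auto

lemma bit_size_sum_list_le: "bit_size (Num (sum_list r)) \<le> bit_size (enc_list (map Num r))"
proof (induction r)
  case (Cons x r)
  then show ?case using floor_log_add_le[of x "sum_list r"] by simp
qed simp

text \<open>Times are bounded in the length of the instance, but the input also contains
  \<open>ybar\<close>. Each of its entries is at most the cost of some solution, hence at most a row
  sum, which is no longer than the encoded row.\<close>

lemma bit_size_reference_point_le:
  assumes P: "multicriteria_problem P" and I: "I \<in> instances P" and y: "ybar \<in> reference_points P I"
  shows "bit_size (enc_vec ybar) \<le> bit_size (enc_mat (snd I))"
proof -
  let ?k = "num_crit P (fst I)" and ?n = "num_vars P (fst I)" and ?C = "snd I"
  have C: "?C \<in> carrier_mat ?k ?n" using P I by (rule instance_carrier)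
  obtain x where x: "x \<in> solutions P I" using solutions_nonempty[OF P I] by blast
  have yk: "ybar \<in> carrier_vec ?k" and yx: "\<And>i. i < ?k \<Longrightarrow> ybar $ i \<le> cost I x $ i"
    using y x unfolding reference_points_iff[OF P I] by auto
  have "bit_size (Num (ybar $ i)) \<le> bit_size (enc_list (map Num (mat_to_list ?C ! i)))" if i: "i < ?k" for i
  proof -
    have "ybar $ i \<le> cost I x $ i" by (rule yx[OF i])
    also have "\<dots> = (\<Sum>j<?n. ?C $$ (i, j) * x $ j)"
      by (rule cost_nth[OF C solutions_binary(1)[OF P I x] i])
    also have "\<dots> \<le> (\<Sum>j<?n. ?C $$ (i, j))"
      using solutions_binary(2)[OF P I x] by (intro sum_mono) fastforce
    also have "\<dots> = sum_list (mat_to_list ?C ! i)"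
      using C i by (simp add: mat_to_list_def sum_list_distinct_conv_sum_set atLeast0LessThan)
    finally have "bit_size (Num (ybar $ i)) \<le> bit_size (Num (sum_list (mat_to_list ?C ! i)))"
      by (simp add: floor_log_le_iff)
    then show ?thesis using bit_size_sum_list_le order_trans by blast
  qed
  then show ?thesis
    unfolding enc_vec_def enc_mat_def using C yk
    by (intro bit_size_enc_list_mono) (auto simp: list_all2_conv_all_nth mat_to_list_def list_of_vec_index)
qed

lemma error_count_le:
  assumes "0 < dim_row (snd I)"
  shows "error_count (snd I) \<le> (bit_size (enc_instance I) + 2) ^ 2"
proof -
  let ?C = "snd I"
  have "length (mat_to_list ?C) = dim_row ?C" "length (mat_to_list ?C ! 0) = dim_col ?C"
    using assms by (auto simp: mat_to_list_def)
  moreover have "mat_to_list ?C ! 0 \<in> set (mat_to_list ?C)"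
    using assms by (intro nth_mem) (simp add: mat_to_list_def)
  then have "bit_size (enc_list (map Num (mat_to_list ?C ! 0))) \<le> bit_size (enc_mat ?C)"
    unfolding enc_mat_def by (intro bit_size_le_enc_list) simp
  ultimately have "dim_row ?C \<le> bit_size (enc_mat ?C)" "dim_col ?C \<le> bit_size (enc_mat ?C)"
    using length_le_bit_size_enc_list[of "map (\<lambda>row. enc_list (map Num row)) (mat_to_list ?C)"]
      length_le_bit_size_enc_list[of "map Num (mat_to_list ?C ! 0)"]
    by (auto simp: enc_mat_def)
  then show ?thesis
    unfolding error_count_def power2_eq_square enc_instance_def by (intro mult_mono) auto
qed

section \<open>The approximation scheme\<close>

text \<open>Brings a program known only through a time bound into the calculus, by choosing its
  actual times.\<close>

lemma runs_within_poly_computable: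
  assumes "\<And>i. i \<in> S \<Longrightarrow> runs_within A (f i) (g i) (real (\<tau> i))"
    and "poly_bounded S (\<lambda>i. bit_size (f i)) \<tau>"
  shows "poly_computable S f g"
proof -
  have "\<forall>i\<in>S. \<exists>t. exec A (f i) (g i) t \<and> t \<le> \<tau> i"
    using assms(1) by (auto simp: runs_within_def)
  then obtain \<sigma> where \<sigma>: "\<forall>i\<in>S. exec A (f i) (g i) (\<sigma> i) \<and> \<sigma> i \<le> \<tau> i"
    by (rule bchoice[THEN exE])
  have "poly_bounded S (\<lambda>i. bit_size (f i)) \<sigma>"
    using assms(2) by (rule poly_bounded_mono) (use \<sigma> in blast)
  then show ?thesis by (rule poly_computableI) (use \<sigma> in blast)
qed

theorem theorem15:
  fixes P :: mc_problem
    and p :: ereal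
    and L U :: "mc_instance \<Rightarrow> nat vec \<Rightarrow> real"
    and \<pi>\<^sub>1 \<pi>\<^sub>2 :: "real poly"
    and \<pi>\<^sub>3 :: "real poly poly"
  assumes "multicriteria_problem P"
    and "1 \<le> p"
    and "nondecreasing \<pi>\<^sub>1" and "nondecreasing \<pi>\<^sub>2" and "nondecreasing2 \<pi>\<^sub>3"
    and bounds: "\<And>I ybar. I \<in> instances P \<Longrightarrow> ybar \<in> reference_points P I \<Longrightarrow>
      L I ybar \<le> opt_val P p I ybar \<and> opt_val P p I ybar \<le> U I ybar \<and>
      U I ybar \<le> poly \<pi>\<^sub>2 (encoding_length I) * L I ybar"
    and bounds_algorithm: "\<exists>A. \<forall>I\<in>instances P. \<forall>ybar\<in>reference_points P I.
      \<exists>l u. represents l (L I ybar) \<and> represents u (U I ybar) \<and>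
        runs_within A (enc_input I ybar) (Pair l u) (poly \<pi>\<^sub>1 (encoding_length I))"
    and exact_algorithm: "\<exists>A. \<forall>I\<in>instances P. \<forall>ybar\<in>reference_points P I.
      \<exists>x\<in>solutions P I. ref_obj p ybar (cost I x) = opt_val P p I ybar \<and>
        runs_within A (enc_input I ybar) (enc_vec x)
          (poly2 \<pi>\<^sub>3 (encoding_length I) (U I ybar))"
  shows "has_fptas P p"
proof -
  note P = assms(1) and p = assms(2)
  \<comment> \<open>The accuracy \<open>m\<close> belongs to the index, so that one program and one
    polynomial serve all \<epsilon>.\<close>
  define S where "S = {(m :: nat, I, y). 0 < m \<and> I \<in> instances P \<and> y \<in> reference_points P I}"
  define mm :: "nat \<times> mc_instance \<times> nat vec \<Rightarrow> nat" where "mm = fst"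
  define II :: "nat \<times> mc_instance \<times> nat vec \<Rightarrow> mc_instance" where "II = (\<lambda>i. fst (snd i))"
  define yy :: "nat \<times> mc_instance \<times> nat vec \<Rightarrow> nat vec" where "yy = (\<lambda>i. snd (snd i))"
  have S: "0 < mm i" "II i \<in> instances P" "yy i \<in> reference_points P (II i)" if "i \<in> S" for i
    using that by (auto simp: S_def mm_def II_def yy_def)
  define z where "z i = enc_input (II i) (yy i)" for i
  define f where "f i = Pair (Num (mm i)) (z i)" for i
  define len where "len i = bit_size (enc_instance (II i))" for i
  \<comment> \<open>The final measure counts \<open>m\<close> by value, while the input
    \<open>f i\<close> contains it in binary.\<close>
  define W where "W i = len i + mm i" for i
  have z_le: "bit_size (z i) \<le> 1 + 2 * len i" if "i \<in> S" for i
    using bit_size_reference_point_le[OF P S(2,3)[OF that]]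
    by (simp add: z_def len_def enc_input_def enc_instance_def)
  have W_f: "poly_bounded S W (\<lambda>i. bit_size (f i))"
  proof (rule poly_bounded_mono)
    show "poly_bounded S W (\<lambda>i. 3 + 2 * W i)" by (intro poly_bounded_intros)
    show "bit_size (f i) \<le> 3 + 2 * W i" if "i \<in> S" for i
      using z_le[OF that] bit_size_Num_le[of "mm i"] by (simp add: f_def W_def)
  qed

  obtain B where B: "\<And>I y. I \<in> instances P \<Longrightarrow> y \<in> reference_points P I \<Longrightarrow>
      \<exists>l u. represents l (L I y) \<and> represents u (U I y) \<and>
        runs_within B (enc_input I y) (Pair l u) (poly \<pi>\<^sub>1 (encoding_length I))"
    using bounds_algorithm by blast
  \<comment> \<open>A rational number has many representations; fixed here is the fraction that
    \<open>B\<close> outputs, as the rounding program has to read it.\<close>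
  have "\<forall>i\<in>S. \<exists>abu. case abu of (a, b, u) \<Rightarrow> b > 0 \<and> L (II i) (yy i) = real a / real b \<and>
      runs_within B (z i) (Pair (Pair (Num a) (Num b)) u) (poly \<pi>\<^sub>1 (encoding_length (II i)))"
  proof
    fix i assume "i \<in> S"
    from B[OF S(2,3)[OF this]] show "\<exists>abu. case abu of (a, b, u) \<Rightarrow>
      b > 0 \<and> L (II i) (yy i) = real a / real b \<and>
      runs_within B (z i) (Pair (Pair (Num a) (Num b)) u) (poly \<pi>\<^sub>1 (encoding_length (II i)))"
      unfolding represents_def z_def by fast
  qed
  then obtain abu where abu: "\<forall>i\<in>S. case abu i of (a, b, u) \<Rightarrow> b > 0 \<and> L (II i) (yy i) = real a / real b \<and>
      runs_within B (z i) (Pair (Pair (Num a) (Num b)) u) (poly \<pi>\<^sub>1 (encoding_length (II i)))"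
    by (rule bchoice[THEN exE])
  define a where "a i = fst (abu i)" for i
  define b where "b i = fst (snd (abu i))" for i
  define u where "u i = snd (snd (abu i))" for i
  have ab: "b i > 0" "L (II i) (yy i) = real (a i) / real (b i)"
    "runs_within B (z i) (Pair (Pair (Num (a i)) (Num (b i))) (u i)) (poly \<pi>\<^sub>1 (encoding_length (II i)))"
    if "i \<in> S" for i
    using bspec[OF abu that] by (auto simp: a_def b_def u_def case_prod_beta)

  have f_m: "poly_computable S f (\<lambda>i. Num (mm i))" and f_z: "poly_computable S f z"
    using poly_computable_refl[of S f] unfolding f_def
    by (rule poly_computable_fst, rule poly_computable_snd)
  obtain c\<^sub>1 where c\<^sub>1: "\<And>n. \<bar>poly \<pi>\<^sub>1 (real n)\<bar> \<le> real ((n + 2) ^ c\<^sub>1)"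
    using poly_bounded_poly by blast
  have "poly_computable S z (\<lambda>i. Pair (Pair (Num (a i)) (Num (b i))) (u i))"
  proof (rule runs_within_poly_computable)
    show "runs_within B (z i) (Pair (Pair (Num (a i)) (Num (b i))) (u i)) (real ((len i + 2) ^ c\<^sub>1))"
      if "i \<in> S" for i
      using ab(3)[OF that] c\<^sub>1[of "len i"] unfolding runs_within_def encoding_length_def len_def
      by (meson abs_le_D1 order_trans)
    show "poly_bounded S (\<lambda>i. bit_size (z i)) (\<lambda>i. (len i + 2) ^ c\<^sub>1)"
      by (rule poly_boundedI[of _ _ _ c\<^sub>1])
        (auto simp: z_def len_def enc_input_def intro!: power_mono)
  qed
  from poly_computable_fst[OF poly_computable_trans[OF f_z this]]
  have f_ab: "poly_computable S f (\<lambda>i. Pair (Num (a i)) (Num (b i)))" .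
  note f_a = poly_computable_fst[OF f_ab] and f_b = poly_computable_snd[OF f_ab]

  \<comment> \<open>The rounded input\<close>
  define K where "K i = mm i * error_count (snd (II i)) * b i" for i
  \<comment> \<open>\<open>a i = 0\<close> leaves no positive unit \<open>a i / K i\<close>, so the
    input is passed on unchanged. Both cases later share the bound \<open>v i\<close>.\<close>
  define I' where "I' i = (if a i = 0 then II i else scaled_instance (K i) (a i) (II i))" for i
  define y' where "y' i = (if a i = 0 then yy i else map_vec (round_down (K i) (a i)) (yy i))" for i
  have row_pos: "0 < dim_row (snd (II i))" if "i \<in> S" for i
    using num_crit_pos[OF P S(2)[OF that]] instance_carrier[OF P S(2)[OF that]] by simp
  have sub: "poly_computable R f g" if "poly_computable S f g" "R \<subseteq> S" for R g
    by (rule poly_computable_reindex[OF that(1), where h = "\<lambda>i. i"]) (use that in auto)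
  have prep: "poly_computable S f (\<lambda>i. enc_input (I' i) (y' i))"
  proof (rule poly_computable_If[OF f_a])
    let ?R = "{i \<in> S. Num (a i) \<noteq> Num 0}"
    have "poly_computable ?R f (\<lambda>i. enc_input (scaled_instance (K i) (a i) (II i))
        (map_vec (round_down (K i) (a i)) (yy i)))"
      by (rule poly_computable_scaled_input[where m = mm and b = b])
        (use row_pos sub[OF f_z[unfolded z_def[abs_def]]] sub[OF f_m] sub[OF f_a] sub[OF f_b] in \<open>auto simp: K_def\<close>)
    then show "poly_computable ?R f (\<lambda>i. enc_input (I' i) (y' i))"
      by (rule poly_computable_cong) (auto simp: I'_def y'_def)
    let ?R = "{i \<in> S. Num (a i) = Num 0}"
    have "poly_computable ?R f z" by (rule sub[OF f_z]) auto
    then show "poly_computable ?R f (\<lambda>i. enc_input (I' i) (y' i))"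
      by (rule poly_computable_cong) (auto simp: I'_def y'_def z_def)
  qed
  have I': "I' i \<in> instances P" and y': "y' i \<in> reference_points P (I' i)"
    and sol: "solutions P (I' i) = solutions P (II i)" if "i \<in> S" for i
    using S[OF that] round_down_in_reference_points[OF P S(2,3)[OF that]]
    by (auto simp: I'_def y'_def scaled_instance_in_instances)

  have L_nonneg: "0 \<le> L (II i) (yy i)" if "i \<in> S" for i
    using ab(2)[OF that] by simp
  have accuracy: "ref_obj p (yy i) (cost (II i) x) \<le> (1 + 1 / real (mm i)) * opt_val P p (II i) (yy i)"
    if i: "i \<in> S" and x: "x \<in> solutions P (II i)"
      and exact: "ref_obj p (y' i) (cost (I' i) x) = opt_val P p (I' i) (y' i)" for i x
  proof (cases "a i = 0")
    case True
    then have "ref_obj p (yy i) (cost (II i) x) = opt_val P p (II i) (yy i)"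
      using exact by (simp add: I'_def y'_def)
    then show ?thesis
      using opt_val_nonneg[OF P p S(2,3)[OF i]] by (simp add: distrib_right)
  next
    case False
    show ?thesis
      by (rule scaled_solution_accuracy[OF P p S(2,3)[OF i] _ ab(1)[OF i] S(1)[OF i] K_def x])
        (use False exact bounds[OF S(2,3)[OF i]] ab(2)[OF i] in \<open>auto simp: I'_def y'_def\<close>)
  qed

  \<comment> \<open>The upper bound for the rounded instance\<close>
  obtain c\<^sub>2 where c\<^sub>2: "\<And>n. \<bar>poly \<pi>\<^sub>2 (real n)\<bar> \<le> real ((n + 2) ^ c\<^sub>2)"
    using poly_bounded_poly by blast
  define len' where "len' i = bit_size (enc_instance (I' i))" for i
  \<comment> \<open>The first factor bounds \<open>\<pi>\<^sub>2\<close> at the length of the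
    rounded instance. The second bounds the rounded optimum by N (m c + 1), with N at most
    \<open>(len i + 2) ^ 2\<close> and c bounding \<open>\<pi>\<^sub>2\<close> at the original
    length.\<close>
  define v where "v i = (len' i + 2) ^ c\<^sub>2 * ((len i + 2) ^ 2 * (mm i * (len i + 2) ^ c\<^sub>2 + 1))" for i
  have U_le: "U I y \<le> real ((bit_size (enc_instance I) + 2) ^ c\<^sub>2) * opt_val P p I y"
    if I: "I \<in> instances P" "y \<in> reference_points P I" and L0: "0 \<le> L I y" for I y
  proof -
    have "U I y \<le> poly \<pi>\<^sub>2 (encoding_length I) * L I y" using bounds[OF I] by simp
    also have "\<dots> \<le> real ((bit_size (enc_instance I) + 2) ^ c\<^sub>2) * opt_val P p I y"
      using bounds[OF I] L0 c\<^sub>2[of "bit_size (enc_instance I)"]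
      by (intro mult_mono) (auto simp: encoding_length_def)
    finally show ?thesis .
  qed
  have opt'_le: "opt_val P p (I' i) (y' i) \<le> real ((len i + 2) ^ 2 * (mm i * (len i + 2) ^ c\<^sub>2 + 1))"
    if i: "i \<in> S" for i
  proof (cases "a i = 0")
    case True
    then have "L (II i) (yy i) = 0" using ab(2)[OF i] by simp
    then have "opt_val P p (II i) (yy i) \<le> 0" using bounds[OF S(2,3)[OF i]] by auto
    then have "opt_val P p (I' i) (y' i) \<le> 0" using True by (simp add: I'_def y'_def)
    then show ?thesis by (rule order_trans) simp
  next
    case False
    let ?c = "real ((len i + 2) ^ c\<^sub>2)"
    have "opt_val P p (II i) (yy i) \<le> U (II i) (yy i)" using bounds[OF S(2,3)[OF i]] by simp
    also have "\<dots> \<le> poly \<pi>\<^sub>2 (encoding_length (II i)) * L (II i) (yy i)"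
      using bounds[OF S(2,3)[OF i]] by simp
    also have "\<dots> \<le> ?c * (real (a i) / real (b i))"
      using L_nonneg[OF i] c\<^sub>2[of "len i"] unfolding ab(2)[OF i, symmetric]
      by (intro mult_right_mono) (auto simp: encoding_length_def len_def)
    finally have "opt_val P p (II i) (yy i) \<le> ?c * (real (a i) / real (b i))" .
    from scaled_opt_val_bound[OF P p S(2,3)[OF i] _ ab(1)[OF i] S(1)[OF i] K_def this] False
    have "opt_val P p (I' i) (y' i) \<le> real (error_count (snd (II i))) * (real (mm i) * ?c + 1)"
      by (simp add: I'_def y'_def)
    also have "\<dots> = real (error_count (snd (II i)) * (mm i * (len i + 2) ^ c\<^sub>2 + 1))"
      by (simp only: of_nat_mult of_nat_add of_nat_1)
    also have "\<dots> \<le> real ((len i + 2) ^ 2 * (mm i * (len i + 2) ^ c\<^sub>2 + 1))"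
      unfolding of_nat_le_iff len_def using error_count_le[OF row_pos[OF i]] by (rule mult_right_mono) simp
    finally show ?thesis .
  qed
  have U'_le: "U (I' i) (y' i) \<le> real (v i)" if i: "i \<in> S" for i
  proof -
    \<comment> \<open>Nonnegativity comes from the output format: the lower bound is printed as a
      quotient of natural numbers.\<close>
    have "0 \<le> L (I' i) (y' i)"
      using B[OF I'[OF i] y'[OF i]] by (auto simp: represents_def)
    from U_le[OF I'[OF i] y'[OF i] this]
    have "U (I' i) (y' i) \<le> real ((len' i + 2) ^ c\<^sub>2) * opt_val P p (I' i) (y' i)"
      by (simp add: len'_def)
    also have "\<dots> \<le> real ((len' i + 2) ^ c\<^sub>2) * real ((len i + 2) ^ 2 * (mm i * (len i + 2) ^ c\<^sub>2 + 1))"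
      using opt'_le[OF i] by (intro mult_left_mono) auto
    finally show ?thesis by (simp add: v_def)
  qed
  \<comment> \<open>Monotonicity of \<open>\<pi>\<^sub>3\<close> is given for nonnegative
    arguments.\<close>
  have U'_nonneg: "0 \<le> U (I' i) (y' i)" if i: "i \<in> S" for i
    using opt_val_nonneg[OF P p I'[OF i] y'[OF i]] bounds[OF I'[OF i] y'[OF i]] by simp

  obtain A where A: "\<And>I y. I \<in> instances P \<Longrightarrow> y \<in> reference_points P I \<Longrightarrow>
      \<exists>x\<in>solutions P I. ref_obj p y (cost I x) = opt_val P p I y \<and>
        runs_within A (enc_input I y) (enc_vec x) (poly2 \<pi>\<^sub>3 (encoding_length I) (U I y))"
    using exact_algorithm by blast
  obtain c\<^sub>3 where c\<^sub>3: "\<And>x y. \<bar>poly2 \<pi>\<^sub>3 (real x) (real y)\<bar> \<le> real ((x + y + 2) ^ c\<^sub>3)"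
    using poly_bounded_poly2 by blast
  define \<tau> where "\<tau> i = (len' i + v i + 2) ^ c\<^sub>3" for i
  have solve: "\<exists>x\<in>solutions P (II i). \<exists>t. exec A (enc_input (I' i) (y' i)) (enc_vec x) t \<and> t \<le> \<tau> i \<and>
      ref_obj p (yy i) (cost (II i) x) \<le> (1 + 1 / real (mm i)) * opt_val P p (II i) (yy i)"
    if i: "i \<in> S" for i
  proof -
    obtain x t where x: "x \<in> solutions P (I' i)"
      "ref_obj p (y' i) (cost (I' i) x) = opt_val P p (I' i) (y' i)"
      and t: "exec A (enc_input (I' i) (y' i)) (enc_vec x) t"
        "real t \<le> poly2 \<pi>\<^sub>3 (encoding_length (I' i)) (U (I' i) (y' i))"
      using A[OF I'[OF i] y'[OF i]] by (auto simp: runs_within_def)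
    note t(2)
    also have "poly2 \<pi>\<^sub>3 (encoding_length (I' i)) (U (I' i) (y' i)) \<le> poly2 \<pi>\<^sub>3 (real (len' i)) (real (v i))"
      using assms(5) U'_le[OF i] U'_nonneg[OF i]
      unfolding nondecreasing2_def encoding_length_def len'_def by simp
    also have "\<dots> \<le> real (\<tau> i)"
      unfolding \<tau>_def using c\<^sub>3[of "len' i" "v i"] by linarith
    finally have "t \<le> \<tau> i" by simp
    then show ?thesis using x t(1) accuracy[OF i] sol[OF i] by blast
  qed

  \<comment> \<open>The total running time\<close>
  obtain F \<sigma> where F: "poly_bounded S (\<lambda>i. bit_size (f i)) \<sigma>"
    "\<And>i. i \<in> S \<Longrightarrow> exec F (f i) (enc_input (I' i) (y' i)) (\<sigma> i)"
    using prep by (rule poly_computableE) blast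
  have W_len: "poly_bounded S W len" and W_m: "poly_bounded S W mm"
    by (rule poly_bounded_le, simp add: W_def)+
  \<comment> \<open>The rounded entries need no estimate of their own: they are the output of a
    polynomial-time program.\<close>
  have "poly_bounded S W (\<lambda>i. bit_size (enc_input (I' i) (y' i)))"
    using W_f poly_computable_size[OF prep] by (rule poly_bounded_trans)
  then have W_len': "poly_bounded S W len'"
    by (rule poly_bounded_mono) (simp add: len'_def enc_input_def)
  have W_v: "poly_bounded S W v"
    unfolding v_def by (intro poly_bounded_intros W_len W_len' W_m)
  \<comment> \<open>Pairing the input with the constant \<open>m\<close> costs at most
    \<open>1 + 4 * bit_size (f i)\<close>, and the two sequential compositions cost 1 each.\<close>
  have "poly_bounded S W (\<lambda>i. 3 + 4 * bit_size (f i) + \<sigma> i + \<tau> i)"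
    unfolding \<tau>_def by (intro poly_bounded_intros W_len' W_v W_f poly_bounded_trans[OF W_f F(1)])
  then obtain c where c: "\<forall>i\<in>S. 3 + 4 * bit_size (f i) + \<sigma> i + \<tau> i \<le> (W i + 2) ^ c"
    unfolding poly_bounded_def by blast

  \<comment> \<open>The base is x + y + 3: 2 comes from \<open>poly_bounded\<close> and 1 from
    rounding 1/\<epsilon> up to \<open>m\<close>.\<close>
  define q :: "real poly poly" where "q = [:[:3, 1:], 1:] ^ c"
  have q: "poly2 q x y = (x + y + 3) ^ c" for x y
    by (simp add: q_def poly2_def poly_power add_ac)
  show ?thesis
    unfolding has_fptas_def
  proof (intro exI[of _ q] allI impI)
    fix \<epsilon> :: real
    assume \<epsilon>: "0 < \<epsilon>"
    define m where "m = nat \<lceil>1 / \<epsilon>\<rceil>"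
    have "0 < 1 / \<epsilon>" using \<epsilon> by simp
    then have "real m = of_int \<lceil>1 / \<epsilon>\<rceil>" "0 < m" unfolding m_def by simp_all
    then have m: "1 / \<epsilon> \<le> real m" "real m \<le> 1 / \<epsilon> + 1" "0 < m" by linarith+
    have m_inv: "1 / real m \<le> \<epsilon>" using m \<epsilon> by (simp add: field_simps)
    \<comment> \<open>Only the constant \<open>m\<close> depends on \<epsilon>; the rounding program
      \<open>F\<close> and the exact algorithm \<open>A\<close> are fixed.\<close>
    let ?A = "Seq (Fork (Elem (Const (Num m))) (Elem Id)) (Seq F A)"
    show "\<exists>A. \<forall>I\<in>instances P. \<forall>ybar\<in>reference_points P I. \<exists>x\<in>solutions P I.
      runs_within A (enc_input I ybar) (enc_vec x) (poly2 q (encoding_length I) (1 / \<epsilon>)) \<and>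
      ref_obj p ybar (cost I x) \<le> (1 + \<epsilon>) * opt_val P p I ybar"
    proof (intro exI[of _ ?A] ballI)
      fix I ybar assume I: "I \<in> instances P" and y: "ybar \<in> reference_points P I"
      define i where "i = (m, I, ybar)"
      have i: "i \<in> S" "mm i = m" "II i = I" "yy i = ybar"
        using I y m(3) by (auto simp: i_def S_def mm_def II_def yy_def)
      obtain x t where x: "x \<in> solutions P I"
        and t: "exec A (enc_input (I' i) (y' i)) (enc_vec x) t" "t \<le> \<tau> i"
        and r: "ref_obj p ybar (cost I x) \<le> (1 + 1 / real m) * opt_val P p I ybar"
        using solve[OF i(1)] unfolding i(2-4) by blast
      have zi: "z i = enc_input I ybar" by (simp add: z_def i)
      obtain t' where t': "exec (Fork (Elem (Const (Num m))) (Elem Id)) (enc_input I ybar) (f i) t'"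
        "t' \<le> 1 + 4 * bit_size (f i)"
      proof
        show "exec (Fork (Elem (Const (Num m))) (Elem Id)) (enc_input I ybar) (f i)
          (1 + bit_size (z i) + (bit_size (z i) + bit_size (Num m)) + (bit_size (z i) + bit_size (z i)))"
          using exec.Fork[OF exec.Elem[of "Const (Num m)" "z i"] exec.Elem[of Id "z i"]]
          by (simp add: f_def i zi)
      qed (simp add: f_def i)
      have run: "exec ?A (enc_input I ybar) (enc_vec x) (1 + t' + (1 + \<sigma> i + t))"
        by (rule exec.Seq[OF t'(1) exec.Seq[OF F(2)[OF i(1)] t(1)]])
      have "1 + t' + (1 + \<sigma> i + t) \<le> 3 + 4 * bit_size (f i) + \<sigma> i + \<tau> i"
        using t(2) t'(2) by simp
      also have "\<dots> \<le> (W i + 2) ^ c" using c i(1) by blast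
      finally have "real (1 + t' + (1 + \<sigma> i + t)) \<le> real ((W i + 2) ^ c)"
        by (simp only: of_nat_le_iff)
      also have "\<dots> = (encoding_length I + real m + 2) ^ c"
        by (simp add: W_def len_def i encoding_length_def add_ac)
      also have "\<dots> \<le> (encoding_length I + 1 / \<epsilon> + 3) ^ c"
        using m(2) by (intro power_mono) (auto simp: encoding_length_def)
      finally have "runs_within ?A (enc_input I ybar) (enc_vec x) (poly2 q (encoding_length I) (1 / \<epsilon>))"
        unfolding runs_within_def q using run by blast
      moreover have "ref_obj p ybar (cost I x) \<le> (1 + \<epsilon>) * opt_val P p I ybar"
        using m_inv opt_val_nonneg[OF P p I y]
        by (intro order_trans[OF r] mult_right_mono) auto
      ultimately show "\<exists>x\<in>solutions P I.
        runs_within ?A (enc_input I ybar) (enc_vec x) (poly2 q (encoding_length I) (1 / \<epsilon>)) \<and>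
        ref_obj p ybar (cost I x) \<le> (1 + \<epsilon>) * opt_val P p I ybar"
        using x by blast
    qed
  qed
qed

end
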